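(* Let $\mathcal{F}_0$ be a transversely oriented codimension one foliation on a smooth manifold $M$. (1) If $\mathcal{F}_0$ can be defined by a $1$-form $\alpha$ for which $\beta$ or $\gamma$ or $\delta$ vanishes (i.e. can be chosen to be identically zero), then $DGV(\mathcal{F}_t)=0$ for all germs at $t=0$ of smooth $1$-parameter families $\mathcal{F}_t$ of codimension one foliations based at $\mathcal{F}_0$. (2) If $\mathcal{F}_0$ can be defined by a $1$-form $\alpha$ such that $\alpha$ or $\beta$ or $\gamma$ or $\delta$ is closed (for $\beta,\gamma,\delta$: can be chosen to be closed), then $DGV(\mathcal{F}_t)=0$ for all germs at $t=0$ of smooth $1$-parameter families $\mathcal{F}_t$ of codimension one foliations based at $\mathcal{F}_0$. Here $\beta,\gamma,\delta$ are $1$-forms on $M$ associated with $\alpha$ by the structure equations $d\alpha=\alpha\wedge\beta$, $d\beta=\alpha\wedge\gamma$, $d\gamma=\beta\wedge\gamma+\alpha\wedge\delta$.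
   Context: All manifolds, foliations, forms and families are of class $C^\infty$. A defining form of a transversely oriented codimension one foliation $\mathcal{F}$ is a nowhere vanishing $1$-form $\alpha$ with $\ker\alpha=T\mathcal{F}$, positive on positively oriented transversals. Given $\alpha$, there exists a $1$-form $\beta$ with $d\alpha=\alpha\wedge\beta$; given $\alpha,\beta$ there exists a $1$-form $\gamma$ with $d\beta=\alpha\wedge\gamma$; given these there exists a $1$-form $\delta$ with $d\gamma=\beta\wedge\gamma+\alpha\wedge\delta$; and then $d\delta=2\beta\wedge\delta+\alpha\wedge\epsilon$ for some $1$-form $\epsilon$. These forms are not unique. For a smooth $1$-parameter family $\mathcal{F}_t$ (or its germ at $t=0$) choose smooth families $\alpha(t)$ of defining forms and $\beta(t)$ with $d\alpha=\alpha\wedge\beta$, and let a dot denote $d/dt$. The form $(\dot\beta\wedge\beta\wedge d\beta)(t)$ is closed and its class $TGV(\mathcal{F}_t)=[(\dot\beta\wedge\beta\wedge d\beta)(t)]\in H^4(M,\mathbb{R})$ is independent of the choices. One defines $DGV(\mathcal{F}_t)=TGV(\mathcal{F}_t)(0)\in H^4(M,\mathbb{R})$, the value at $t=0$, which depends only on the germ of $\mathcal{F}_t$ at $t=0$. *)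

theory Defs
  imports "HOL-Analysis.Analysis" "HOL-Library.Function_Algebras"
begin

section \<open>Smooth functions between normed spaces\<close>

text \<open>These predicates are only meaningful, and only used, for open \<open>S\<close>.\<close>

primrec Ck_on :: "nat \<Rightarrow> 'a::real_normed_vector set \<Rightarrow> ('a \<Rightarrow> 'b::real_normed_vector) \<Rightarrow> bool" where
  "Ck_on 0 S f \<longleftrightarrow> continuous_on S f"
| "Ck_on (Suc k) S f \<longleftrightarrow> (\<forall>x\<in>S. f differentiable (at x)) \<and>
     (\<forall>v. Ck_on k S (\<lambda>x. frechet_derivative f (at x) v))"

definition smooth_on :: "'a::real_normed_vector set \<Rightarrow> ('a \<Rightarrow> 'b::real_normed_vector) \<Rightarrow> bool" where
  "smooth_on S f \<longleftrightarrow> (\<forall>k. Ck_on k S f)"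


section \<open>Smooth manifolds\<close>

text \<open>
  A chart is a pair of its domain and its coordinate map; the values of the coordinate map
  outside the domain are irrelevant. The dimension of the manifold is \<open>DIM('e)\<close>.
\<close>

type_synonym ('a, 'e) chart = "'a set \<times> ('a \<Rightarrow> 'e)"

abbreviation cdom :: "('a, 'e) chart \<Rightarrow> 'a set" where "cdom c \<equiv> fst c"
abbreviation cmap :: "('a, 'e) chart \<Rightarrow> 'a \<Rightarrow> 'e" where "cmap c \<equiv> snd c"

definition cimg :: "('a, 'e) chart \<Rightarrow> 'e set" where
  "cimg c = cmap c ` cdom c"

definition cinv :: "('a, 'e) chart \<Rightarrow> 'e \<Rightarrow> 'a" where
  "cinv c = inv_into (cdom c) (cmap c)"

record ('a, 'e) mfd =
  mtop :: "'a topology"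
  atlas :: "('a, 'e) chart set"

definition is_chart :: "'a topology \<Rightarrow> ('a, 'e::euclidean_space) chart \<Rightarrow> bool" where
  "is_chart X c \<longleftrightarrow> openin X (cdom c) \<and> open (cimg c) \<and>
     homeomorphic_map (subtopology X (cdom c)) (top_of_set (cimg c)) (cmap c)"

definition smooth_manifold :: "('a, 'e::euclidean_space) mfd \<Rightarrow> bool" where
  "smooth_manifold M \<longleftrightarrow>
     Hausdorff_space (mtop M) \<and>
     (\<exists>B. countable B \<and> (\<forall>V\<in>B. openin (mtop M) V) \<and>
        (\<forall>U x. openin (mtop M) U \<and> x \<in> U \<longrightarrow> (\<exists>V\<in>B. x \<in> V \<and> V \<subseteq> U))) \<and>
     (\<forall>c\<in>atlas M. is_chart (mtop M) c) \<and>
     (\<Union>c\<in>atlas M. cdom c) = topspace (mtop M) \<and>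
     (\<forall>c\<in>atlas M. \<forall>c'\<in>atlas M.
        smooth_on (cmap c ` (cdom c \<inter> cdom c')) (cmap c' \<circ> cinv c))"


section \<open>Differential forms\<close>

text \<open>
  A differential form is the family of its coordinate expressions: \<open>\<omega> c x [v1, ..., vk]\<close> is the
  value, at the point with coordinates \<open>x\<close> in the chart \<open>c\<close>, on the tangent vectors with
  coordinates \<open>v1, ..., vk\<close> in that chart. Coordinate expressions are required to be zero for
  arguments without such a meaning (charts outside the atlas, points outside the chart image,
  lists of a length other than the degree), so that equality of forms is equality of functions.
\<close>

type_synonym ('a, 'e) form = "('a, 'e) chart \<Rightarrow> 'e \<Rightarrow> 'e list \<Rightarrow> real"

definition is_form :: "('a, 'e::euclidean_space) mfd \<Rightarrow> nat \<Rightarrow> ('a, 'e) form \<Rightarrow> bool" where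
  "is_form M k \<omega> \<longleftrightarrow>
     (\<forall>c x vs. \<omega> c x vs \<noteq> 0 \<longrightarrow> c \<in> atlas M \<and> x \<in> cimg c \<and> length vs = k) \<and>
     (\<forall>c\<in>atlas M. \<forall>x\<in>cimg c. \<forall>vs. length vs = k \<longrightarrow>
        (\<forall>i<k. linear (\<lambda>v. \<omega> c x (vs[i := v]))) \<and>
        (\<not> distinct vs \<longrightarrow> \<omega> c x vs = 0)) \<and>
     (\<forall>c\<in>atlas M. \<forall>vs. length vs = k \<longrightarrow> smooth_on (cimg c) (\<lambda>x. \<omega> c x vs)) \<and>
     (\<forall>c\<in>atlas M. \<forall>c'\<in>atlas M. \<forall>p\<in>cdom c \<inter> cdom c'. \<forall>vs. length vs = k \<longrightarrow>
        \<omega> c (cmap c p) vs =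
        \<omega> c' (cmap c' p) (map (frechet_derivative (cmap c' \<circ> cinv c) (at (cmap c p))) vs))"

text \<open>
  The wedge product as a signed sum over shuffles: \<open>S\<close> is the set of positions of the arguments
  that are fed to the first factor. Only sets \<open>S\<close> whose size is the degree of the first factor
  contribute, because a form vanishes on lists of the wrong length. For one-forms this gives
  \<open>(\<alpha> \<and> \<beta>)(v, w) = \<alpha>(v) \<beta>(w) - \<alpha>(w) \<beta>(v)\<close>.
\<close>

definition shuffle_sign :: "nat \<Rightarrow> nat set \<Rightarrow> real" where
  "shuffle_sign n S = (- 1) ^ card {(i, j). i \<in> S \<and> j \<in> {..<n} - S \<and> j < i}"

definition wedge :: "('a, 'e) form \<Rightarrow> ('a, 'e) form \<Rightarrow> ('a, 'e) form"  (infixl "\<and>\<^sub>f" 70) where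
  "\<alpha> \<and>\<^sub>f \<beta> = (\<lambda>c x vs. \<Sum>S\<in>Pow {..<length vs}.
     shuffle_sign (length vs) S * \<alpha> c x (nths vs S) * \<beta> c x (nths vs (- S)))"

text \<open>
  The exterior derivative in coordinates:
  \<open>d\<omega>(v0, ..., vk) = (\<Sum>i. (-1)^i D\<^bsub>vi\<^esub> (\<omega>(v0, ..., vk without vi)))\<close> for constant \<open>v0, ..., vk\<close>.
\<close>

definition ext_d :: "('a, 'e::euclidean_space) form \<Rightarrow> ('a, 'e) form" where
  "ext_d \<omega> = (\<lambda>c x vs. if x \<in> cimg c
     then \<Sum>i<length vs. (- 1) ^ i *
            frechet_derivative (\<lambda>y. \<omega> c y (nths vs (- {i}))) (at x) (vs ! i)
     else 0)"

definition closed_form :: "('a, 'e::euclidean_space) mfd \<Rightarrow> nat \<Rightarrow> ('a, 'e) form \<Rightarrow> bool" where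
  "closed_form M k \<omega> \<longleftrightarrow> is_form M k \<omega> \<and> ext_d \<omega> = 0"

definition exact_form :: "('a, 'e::euclidean_space) mfd \<Rightarrow> nat \<Rightarrow> ('a, 'e) form \<Rightarrow> bool" where
  "exact_form M k \<omega> \<longleftrightarrow> \<omega> = 0 \<or> (\<exists>j \<eta>. k = Suc j \<and> is_form M j \<eta> \<and> \<omega> = ext_d \<eta>)"

text \<open>
  The de Rham class of \<open>\<omega>\<close>, as a coset of the exact forms in the closed forms. The zero element of
  the cohomology group is \<open>derham_class M k 0\<close>.
\<close>

definition derham_class ::
  "('a, 'e::euclidean_space) mfd \<Rightarrow> nat \<Rightarrow> ('a, 'e) form \<Rightarrow> ('a, 'e) form set" where
  "derham_class M k \<omega> = {\<eta>. closed_form M k \<eta> \<and> exact_form M k (\<eta> - \<omega>)}"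

text \<open>Smooth families of forms, with parameter in the interval from \<open>- \<epsilon>\<close> to \<open>\<epsilon>\<close>.\<close>

definition smooth_form_family ::
  "('a, 'e::euclidean_space) mfd \<Rightarrow> nat \<Rightarrow> real \<Rightarrow> (real \<Rightarrow> ('a, 'e) form) \<Rightarrow> bool" where
  "smooth_form_family M k \<epsilon> \<omega> \<longleftrightarrow>
     (\<forall>t\<in>{-\<epsilon><..<\<epsilon>}. is_form M k (\<omega> t)) \<and>
     (\<forall>c\<in>atlas M. \<forall>vs. length vs = k \<longrightarrow>
        smooth_on ({-\<epsilon><..<\<epsilon>} \<times> cimg c) (\<lambda>(t, x). \<omega> t c x vs))"

definition form_dot :: "(real \<Rightarrow> ('a, 'e) form) \<Rightarrow> real \<Rightarrow> ('a, 'e) form" where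
  "form_dot \<omega> t = (\<lambda>c x vs. deriv (\<lambda>s. \<omega> s c x vs) t)"


section \<open>Transversely oriented codimension one foliations\<close>

text \<open>
  The coordinate expression, in the chart \<open>c\<close>, of the differential at \<open>p\<close> of a real function.
\<close>

definition fdiff :: "('a \<Rightarrow> real) \<Rightarrow> ('a, 'e::euclidean_space) chart \<Rightarrow> 'a \<Rightarrow> 'e \<Rightarrow> real" where
  "fdiff f c p = frechet_derivative (f \<circ> cinv c) (at (cmap c p))"

text \<open>A smooth submersion \<open>f\<close> to the reals defined on the open subset \<open>U\<close> of the manifold.\<close>

definition submersion_on :: "('a, 'e::euclidean_space) mfd \<Rightarrow> 'a set \<Rightarrow> ('a \<Rightarrow> real) \<Rightarrow> bool" where
  "submersion_on M U f \<longleftrightarrow> openin (mtop M) U \<and>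
     (\<forall>c\<in>atlas M. smooth_on (cmap c ` (U \<inter> cdom c)) (f \<circ> cinv c) \<and>
        (\<forall>p\<in>U \<inter> cdom c. \<exists>v. fdiff f c p v \<noteq> 0))"

text \<open>
  Two local submersions define the same transversely oriented foliation on the intersection of
  their domains if, locally, each is the other one followed by an orientation preserving
  local diffeomorphism between open sets of reals.
\<close>

definition transversely_compatible ::
  "('a, 'e::euclidean_space) mfd \<Rightarrow> 'a set \<times> ('a \<Rightarrow> real) \<Rightarrow> 'a set \<times> ('a \<Rightarrow> real) \<Rightarrow> bool" where
  "transversely_compatible M = (\<lambda>(U, f) (V, g). \<forall>p\<in>U \<inter> V. \<exists>W I h.
     openin (mtop M) W \<and> p \<in> W \<and> W \<subseteq> U \<inter> V \<and>
     open I \<and> f ` W \<subseteq> I \<and> smooth_on I h \<and> (\<forall>s\<in>I. deriv h s > 0) \<and>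
     (\<forall>q\<in>W. g q = h (f q)))"

text \<open>
  A transversely oriented codimension one foliation is a maximal atlas of pairwise compatible
  local submersions to the reals (its distinguished functions). The leaves are locally the
  connected components of their level sets, and positively oriented transversals are those along
  which they increase.
\<close>

type_synonym 'a foliation = "('a set \<times> ('a \<Rightarrow> real)) set"

definition foliation :: "('a, 'e::euclidean_space) mfd \<Rightarrow> 'a foliation \<Rightarrow> bool" where
  "foliation M F \<longleftrightarrow>
     (\<forall>(U, f)\<in>F. submersion_on M U f) \<and>
     (\<Union>(U, f)\<in>F. U) = topspace (mtop M) \<and>
     (\<forall>a\<in>F. \<forall>b\<in>F. transversely_compatible M a b) \<and>
     (\<forall>U f. submersion_on M U f \<and>
        (\<forall>b\<in>F. transversely_compatible M (U, f) b \<and> transversely_compatible M b (U, f))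
        \<longrightarrow> (U, f) \<in> F)"

definition defining_form ::
  "('a, 'e::euclidean_space) mfd \<Rightarrow> 'a foliation \<Rightarrow> ('a, 'e) form \<Rightarrow> bool" where
  "defining_form M F \<alpha> \<longleftrightarrow> is_form M 1 \<alpha> \<and>
     (\<forall>c\<in>atlas M. \<forall>x\<in>cimg c. \<exists>v. \<alpha> c x [v] \<noteq> 0) \<and>
     (\<forall>(U, f)\<in>F. \<forall>c\<in>atlas M. \<forall>p\<in>U \<inter> cdom c. \<forall>v.
        (\<alpha> c (cmap c p) [v] = 0 \<longleftrightarrow> fdiff f c p v = 0) \<and>
        (fdiff f c p v > 0 \<longrightarrow> \<alpha> c (cmap c p) [v] > 0))"

text \<open>
  The germ at parameter \<open>0\<close> of a smooth family of foliations: for small parameters, the family is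
  locally given by distinguished functions that depend smoothly on the parameter and the point.
  Values of the family for other parameters are irrelevant.
\<close>

definition foliation_family_germ ::
  "('a, 'e::euclidean_space) mfd \<Rightarrow> (real \<Rightarrow> 'a foliation) \<Rightarrow> bool" where
  "foliation_family_germ M F \<longleftrightarrow> (\<exists>\<epsilon>>0.
     (\<forall>t\<in>{-\<epsilon><..<\<epsilon>}. foliation M (F t)) \<and>
     (\<forall>t0\<in>{-\<epsilon><..<\<epsilon>}. \<forall>p\<in>topspace (mtop M). \<exists>\<delta>>0. \<exists>U G.
        p \<in> U \<and> {t0 - \<delta><..<t0 + \<delta>} \<subseteq> {-\<epsilon><..<\<epsilon>} \<and>
        (\<forall>t\<in>{t0 - \<delta><..<t0 + \<delta>}. (U, G t) \<in> F t) \<and>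
        (\<forall>c\<in>atlas M. smooth_on ({t0 - \<delta><..<t0 + \<delta>} \<times> cmap c ` (U \<inter> cdom c))
           (\<lambda>(t, x). G t (cinv c x)))))"


section \<open>Structure equations and the classes TGV and DGV\<close>

definition beta_for :: "('a, 'e::euclidean_space) mfd \<Rightarrow> ('a, 'e) form \<Rightarrow> ('a, 'e) form \<Rightarrow> bool" where
  "beta_for M \<alpha> \<beta> \<longleftrightarrow> is_form M 1 \<beta> \<and> ext_d \<alpha> = \<alpha> \<and>\<^sub>f \<beta>"

definition gamma_for ::
  "('a, 'e::euclidean_space) mfd \<Rightarrow> ('a, 'e) form \<Rightarrow> ('a, 'e) form \<Rightarrow> ('a, 'e) form \<Rightarrow> bool" where
  "gamma_for M \<alpha> \<beta> \<gamma> \<longleftrightarrow> is_form M 1 \<gamma> \<and> ext_d \<beta> = \<alpha> \<and>\<^sub>f \<gamma>"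

definition delta_for ::
  "('a, 'e::euclidean_space) mfd \<Rightarrow> ('a, 'e) form \<Rightarrow> ('a, 'e) form \<Rightarrow> ('a, 'e) form \<Rightarrow>
   ('a, 'e) form \<Rightarrow> bool" where
  "delta_for M \<alpha> \<beta> \<gamma> \<delta> \<longleftrightarrow> is_form M 1 \<delta> \<and> ext_d \<gamma> = \<beta> \<and>\<^sub>f \<gamma> + \<alpha> \<and>\<^sub>f \<delta>"

definition tgv_form :: "(real \<Rightarrow> ('a, 'e::euclidean_space) form) \<Rightarrow> real \<Rightarrow> ('a, 'e) form" where
  "tgv_form \<beta> t = form_dot \<beta> t \<and>\<^sub>f \<beta> t \<and>\<^sub>f ext_d (\<beta> t)"

text \<open>
  \<open>has_TGV M F t C\<close> says that some admissible choice of \<open>\<alpha>\<close> and \<open>\<beta>\<close> for the germ \<open>F\<close> yields the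
  class \<open>C\<close> at parameter \<open>t\<close>. That the class exists and does not depend on the choice is a
  theorem, which is why \<open>TGV\<close> and \<open>DGV\<close> are introduced as relations.
\<close>

definition has_TGV ::
  "('a, 'e::euclidean_space) mfd \<Rightarrow> (real \<Rightarrow> 'a foliation) \<Rightarrow> real \<Rightarrow> ('a, 'e) form set \<Rightarrow> bool" where
  "has_TGV M F t C \<longleftrightarrow> (\<exists>\<epsilon>>0. \<exists>\<alpha> \<beta>. t \<in> {-\<epsilon><..<\<epsilon>} \<and>
     smooth_form_family M 1 \<epsilon> \<alpha> \<and> smooth_form_family M 1 \<epsilon> \<beta> \<and>
     (\<forall>s\<in>{-\<epsilon><..<\<epsilon>}. defining_form M (F s) (\<alpha> s) \<and> beta_for M (\<alpha> s) (\<beta> s)) \<and>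
     C = derham_class M 4 (tgv_form \<beta> t))"

definition has_DGV ::
  "('a, 'e::euclidean_space) mfd \<Rightarrow> (real \<Rightarrow> 'a foliation) \<Rightarrow> ('a, 'e) form set \<Rightarrow> bool" where
  "has_DGV M F C \<longleftrightarrow> has_TGV M F 0 C"

end

theory Submission
  imports Defs
begin

text \<open>
  Let \<open>\<alpha>0\<close> and \<open>B\<close> be the members at parameter \<open>0\<close> of admissible families of defining and structure
  forms, and let \<open>a\<close> and \<open>b\<close> be their derivatives in the parameter. The class in question is that of
  \<open>b \<and> B \<and> dB\<close>. The family enters through the derivative of its structure equation,
  \<open>da = a \<and> B + \<alpha>0 \<and> b\<close>, together with \<open>d\<alpha>0 = \<alpha>0 \<and> B\<close>.

  The given data \<open>\<alpha>\<close>, \<open>\<beta>\<close>, \<open>\<gamma>\<close>, \<open>\<delta>\<close> belong to another defining form of the same foliation. Hence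
  \<open>\<alpha> = k \<alpha>0\<close> with a positive function \<open>k\<close>, and comparing structure equations gives
  \<open>B = \<beta> + g \<alpha> - dl\<close> with \<open>l = - log k\<close> and a function \<open>g\<close>. With \<open>A = k a\<close> and \<open>b' = b - g A\<close> the
  equation for \<open>da\<close> becomes \<open>dA = A \<and> \<beta> + \<alpha> \<and> b'\<close>, and
  \<open>b \<and> B \<and> dB = b' \<and> \<beta> \<and> d\<beta> + d (l b \<and> dB + g \<beta> \<and> dA - (g\<^sup>2 / 2) A \<and> d\<alpha>)\<close>.
  So the given data may be used to compute the class (\<open>tgv_form_gauge_change\<close>). Apart from the Leibniz
  rule, this needs \<open>db \<and> dB = 0\<close>, which holds because \<open>dB\<close> is divisible by \<open>\<alpha>\<close> and
  \<open>d (da) = 0\<close> amounts to \<open>\<alpha> \<and> db = - A \<and> dB\<close>.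

  Now \<open>b' \<and> \<beta> \<and> d\<beta> = \<alpha> \<and> b' \<and> \<beta> \<and> \<gamma>\<close>. If \<open>\<gamma>\<close> is closed, \<open>d (d\<beta>) = 0\<close> gives
  \<open>\<alpha> \<and> \<beta> \<and> \<gamma> = \<alpha> \<and> d\<gamma> = 0\<close>, so this form vanishes. If \<open>\<delta>\<close> is closed, \<open>d (d\<gamma>) = 0\<close> gives
  \<open>\<alpha> \<and> \<beta> \<and> \<delta> = 0\<close>, and replacing \<open>\<alpha> \<and> b'\<close> by \<open>dA - A \<and> \<beta>\<close> and \<open>\<beta> \<and> \<gamma>\<close> by \<open>d\<gamma> - \<alpha> \<and> \<delta>\<close> turns
  the form into \<open>dA \<and> d\<gamma> = d (A \<and> d\<gamma>)\<close>. The other hypotheses are instances of these: if \<open>\<alpha>\<close> is closed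
  then \<open>\<beta> = 0\<close> is admissible, and if \<open>\<beta>\<close> is closed then \<open>\<gamma> = 0\<close> is.

  All primitives above are sums of products \<open>\<sigma> \<and> d\<tau>\<close> of one-forms \<open>\<sigma>\<close>, \<open>\<tau>\<close>, with
  \<open>d (\<sigma> \<and> d\<tau>) = d\<sigma> \<and> d\<tau>\<close>. Therefore wedge products and derivatives of low degree suffice; they are
  evaluated on lists of vectors at a point of a chart, which turns every identity between forms
  into one between polynomials in real numbers.
\<close>

section \<open>Smooth functions\<close>

lemma frechet_derivative_eqI:
  "(f has_derivative f') (at x) \<Longrightarrow> frechet_derivative f (at x) = f'"
  by (metis frechet_derivative_at)

lemma frechet_derivative_cong_open:
  assumes "open S" "x \<in> S" "\<And>y. y \<in> S \<Longrightarrow> f y = g y"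
  shows "frechet_derivative f (at x) = frechet_derivative g (at x)"
proof -
  have "(f has_derivative D) (at x) = (g has_derivative D) (at x)" for D
    using assms by (metis has_derivative_transform_within_open)
  then show ?thesis by (simp add: frechet_derivative_def)
qed

lemma differentiable_cong_open:
  assumes "open S" "x \<in> S" "\<And>y. y \<in> S \<Longrightarrow> f y = g y" "f differentiable (at x)"
  shows "g differentiable (at x)"
  using assms unfolding differentiable_def by (metis has_derivative_transform_within_open)

lemma differentiable_has_frechet_derivative:
  "f differentiable (at x) \<Longrightarrow> (f has_derivative frechet_derivative f (at x)) (at x)"
  using frechet_derivative_works by blast

lemma Ck_on_cong:
  assumes "open S" "\<And>x. x \<in> S \<Longrightarrow> f x = g x" "Ck_on k S f"
  shows "Ck_on k S g"
  using assms(2,3)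
proof (induction k arbitrary: f g)
  case 0
  then show ?case using continuous_on_cong by (simp cong: continuous_on_cong)
next
  case (Suc k)
  have "Ck_on k S (\<lambda>x. frechet_derivative g (at x) v)" for v
  proof (rule Suc.IH)
    show "frechet_derivative f (at x) v = frechet_derivative g (at x) v" if "x \<in> S" for x
      by (simp add: frechet_derivative_cong_open[OF assms(1) that Suc.prems(1)])
    show "Ck_on k S (\<lambda>x. frechet_derivative f (at x) v)"
      using Suc.prems(2) by simp
  qed
  moreover have "\<forall>x\<in>S. g differentiable (at x)"
    using Suc.prems differentiable_cong_open[OF assms(1), where f=f and g=g] by auto
  ultimately show ?case by simp
qed

lemma Ck_on_SucD: "Ck_on (Suc k) S f \<Longrightarrow> Ck_on k S f"
proof (induction k arbitrary: f)
  case 0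
  then show ?case
    by (auto intro!: continuous_at_imp_continuous_on differentiable_imp_continuous_within)
next
  case (Suc k)
  then show ?case by (metis Ck_on.simps(2))
qed

lemma Ck_on_const [simp]: "Ck_on k S (\<lambda>x. c)"
  by (induction k arbitrary: c) auto

lemma Ck_on_add:
  assumes "open S" "Ck_on k S f" "Ck_on k S g"
  shows "Ck_on k S (\<lambda>x. f x + g x)"
  using assms(2,3)
proof (induction k arbitrary: f g)
  case (Suc k)
  have "Ck_on k S (\<lambda>x. frechet_derivative (\<lambda>x. f x + g x) (at x) v)" for v
  proof (rule Ck_on_cong[OF \<open>open S\<close>])
    fix x assume "x \<in> S"
    then show "frechet_derivative f (at x) v + frechet_derivative g (at x) v
       = frechet_derivative (\<lambda>x. f x + g x) (at x) v"
      using Suc.prems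
      by (subst frechet_derivative_eqI[OF has_derivative_add])
        (auto intro: differentiable_has_frechet_derivative)
  qed (use Suc in auto)
  then show ?case using Suc.prems by auto
qed (simp add: continuous_on_add)

lemma frechet_derivative_mult:
  fixes f g :: "'a::real_normed_vector \<Rightarrow> real"
  assumes "f differentiable (at x)" "g differentiable (at x)"
  shows "frechet_derivative (\<lambda>x. f x * g x) (at x) v =
    f x * frechet_derivative g (at x) v + frechet_derivative f (at x) v * g x"
  using assms
  by (subst frechet_derivative_eqI[OF has_derivative_mult])
     (auto intro: differentiable_has_frechet_derivative)

lemma Ck_on_mult:
  fixes f g :: "'a::real_normed_vector \<Rightarrow> real"
  assumes "open S" "Ck_on k S f" "Ck_on k S g"
  shows "Ck_on k S (\<lambda>x. f x * g x)"
  using assms(2,3)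
proof (induction k arbitrary: f g)
  case (Suc k)
  have "Ck_on k S (\<lambda>x. frechet_derivative (\<lambda>x. f x * g x) (at x) v)" for v
  proof (rule Ck_on_cong[OF \<open>open S\<close>])
    show "Ck_on k S (\<lambda>x. f x * frechet_derivative g (at x) v + frechet_derivative f (at x) v * g x)"
      using Suc.prems Suc.prems[THEN Ck_on_SucD] by (intro Ck_on_add[OF \<open>open S\<close>] Suc.IH) simp_all
  qed (use Suc.prems in \<open>auto simp: frechet_derivative_mult\<close>)
  then show ?case using Suc.prems by auto
qed (simp add: continuous_on_mult)

lemma Ck_on_inverse:
  fixes f :: "'a::real_normed_vector \<Rightarrow> real"
  assumes "open S" "\<And>x. x \<in> S \<Longrightarrow> f x \<noteq> 0" "Ck_on k S f"
  shows "Ck_on k S (\<lambda>x. inverse (f x))"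
  using assms(3)
proof (induction k)
  case (Suc k)
  have d: "((\<lambda>x. inverse (f x)) has_derivative
      (\<lambda>v. - (inverse (f x) * frechet_derivative f (at x) v * inverse (f x)))) (at x)"
    if "x \<in> S" for x
    using that Suc.prems assms(2)
    by (intro Deriv.has_derivative_inverse differentiable_has_frechet_derivative) auto
  have "Ck_on k S (\<lambda>x. frechet_derivative (\<lambda>x. inverse (f x)) (at x) v)" for v
  proof (rule Ck_on_cong[OF \<open>open S\<close>])
    show "Ck_on k S (\<lambda>x. (-1) * (inverse (f x) * frechet_derivative f (at x) v * inverse (f x)))"
      using Suc Ck_on_SucD[OF Suc.prems] by (intro Ck_on_mult[OF \<open>open S\<close>]) auto
  qed (simp add: frechet_derivative_eqI[OF d])
  then show ?case using d by (auto simp: differentiable_def)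
qed (use assms in \<open>auto intro!: continuous_intros\<close>)

lemma Ck_on_ln:
  fixes f :: "'a::real_normed_vector \<Rightarrow> real"
  assumes "open S" "\<And>x. x \<in> S \<Longrightarrow> f x > 0" "Ck_on k S f"
  shows "Ck_on k S (\<lambda>x. ln (f x))"
proof (cases k)
  case (Suc m)
  have d: "((\<lambda>x. ln (f x)) has_derivative
      (\<lambda>v. frechet_derivative f (at x) v * inverse (f x))) (at x)"
    if "x \<in> S" for x
    using that Suc assms(2,3)
    by (intro has_derivative_ln[THEN has_derivative_eq_rhs] differentiable_has_frechet_derivative)
       (auto simp: divide_inverse differentiable_has_frechet_derivative)
  have nz: "\<And>x. x \<in> S \<Longrightarrow> f x \<noteq> 0" using assms(2) by force
  have "Ck_on m S (\<lambda>x. frechet_derivative (\<lambda>x. ln (f x)) (at x) v)" for v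
  proof (rule Ck_on_cong[OF \<open>open S\<close>])
    show "Ck_on m S (\<lambda>x. frechet_derivative f (at x) v * inverse (f x))"
      using assms(3) nz Suc Ck_on_SucD[of m S f] by (intro Ck_on_mult[OF \<open>open S\<close>] Ck_on_inverse[OF \<open>open S\<close>]) auto
  qed (simp add: frechet_derivative_eqI[OF d])
  then show ?thesis using d Suc by (auto simp: differentiable_def)
next
  case 0
  then show ?thesis using assms by (fastforce intro!: continuous_on_ln)
qed

lemma smooth_on_const [simp]: "smooth_on S (\<lambda>x. c)"
  by (simp add: smooth_on_def)

lemma smooth_on_add:
  "open S \<Longrightarrow> smooth_on S f \<Longrightarrow> smooth_on S g \<Longrightarrow> smooth_on S (\<lambda>x. f x + g x)"
  by (simp add: smooth_on_def Ck_on_add)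

lemma smooth_on_mult:
  fixes f g :: "'a::real_normed_vector \<Rightarrow> real"
  shows "open S \<Longrightarrow> smooth_on S f \<Longrightarrow> smooth_on S g \<Longrightarrow> smooth_on S (\<lambda>x. f x * g x)"
  by (simp add: smooth_on_def Ck_on_mult)

lemma smooth_on_minus:
  fixes f :: "'a::real_normed_vector \<Rightarrow> real"
  shows "open S \<Longrightarrow> smooth_on S f \<Longrightarrow> smooth_on S (\<lambda>x. - f x)"
  using smooth_on_mult[of S "\<lambda>x. -1" f] by simp

lemma smooth_on_sum:
  "open S \<Longrightarrow> (\<And>i. i \<in> I \<Longrightarrow> smooth_on S (f i)) \<Longrightarrow> smooth_on S (\<lambda>x. \<Sum>i\<in>I. f i x)"
  by (induction I rule: infinite_finite_induct) (auto simp: smooth_on_add)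

lemma smooth_on_divide:
  fixes f g :: "'a::real_normed_vector \<Rightarrow> real"
  assumes "open S" "smooth_on S f" "smooth_on S g" "\<And>x. x \<in> S \<Longrightarrow> g x \<noteq> 0"
  shows "smooth_on S (\<lambda>x. f x / g x)"
  using assms by (auto simp: smooth_on_def divide_inverse intro!: Ck_on_mult Ck_on_inverse)

lemma smooth_on_ln:
  fixes f :: "'a::real_normed_vector \<Rightarrow> real"
  shows "open S \<Longrightarrow> smooth_on S f \<Longrightarrow> (\<And>x. x \<in> S \<Longrightarrow> f x > 0) \<Longrightarrow> smooth_on S (\<lambda>x. ln (f x))"
  by (simp add: smooth_on_def Ck_on_ln)

lemma smooth_on_cong:
  "open S \<Longrightarrow> (\<And>x. x \<in> S \<Longrightarrow> f x = g x) \<Longrightarrow> smooth_on S f \<Longrightarrow> smooth_on S g"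
  using Ck_on_cong[of S f g] by (simp add: smooth_on_def)

lemma smooth_on_differentiable: "smooth_on S f \<Longrightarrow> x \<in> S \<Longrightarrow> f differentiable (at x)"
  unfolding smooth_on_def by (metis Ck_on.simps(2))

lemma smooth_on_frechet_derivative:
  "smooth_on S f \<Longrightarrow> smooth_on S (\<lambda>x. frechet_derivative f (at x) v)"
  unfolding smooth_on_def by (metis Ck_on.simps(2))

lemma smooth_on_continuous: "smooth_on S f \<Longrightarrow> continuous_on S f"
  unfolding smooth_on_def by (metis Ck_on.simps(1))

text \<open>
  The two partial derivatives of a function of a parameter and a point, read off from its total
  derivative. Families of forms are smooth jointly in both arguments, so statements about the
  derivative in the parameter become statements about directional derivatives on the product.
\<close>

lemma frechet_derivative_slice:
  assumes "F differentiable (at (t, x))"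
  shows "((\<lambda>y. F (t, y)) has_derivative (\<lambda>v. frechet_derivative F (at (t, x)) (0, v))) (at x)"
    and "((\<lambda>s. F (s, x)) has_derivative (\<lambda>w. frechet_derivative F (at (t, x)) (w, 0))) (at t)"
proof -
  have F: "(F has_derivative frechet_derivative F (at (t, x))) (at (t, x))"
    using assms differentiable_has_frechet_derivative by blast
  have "((\<lambda>y. (t, y)) has_derivative (\<lambda>v. (0, v))) (at x)"
    "((\<lambda>s. (s, x)) has_derivative (\<lambda>w. (w, 0))) (at t)"
    by (auto intro!: derivative_eq_intros)
  from this[THEN has_derivative_compose, OF F]
  show "((\<lambda>y. F (t, y)) has_derivative (\<lambda>v. frechet_derivative F (at (t, x)) (0, v))) (at x)"
    "((\<lambda>s. F (s, x)) has_derivative (\<lambda>w. frechet_derivative F (at (t, x)) (w, 0))) (at t)" .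
qed

lemma DERIV_slice:
  fixes F :: "real \<times> 'a::real_normed_vector \<Rightarrow> real"
  assumes F: "F differentiable (at (t, x))"
  shows "((\<lambda>s. F (s, x)) has_real_derivative frechet_derivative F (at (t, x)) (1, 0)) (at t)"
proof -
  have "frechet_derivative F (at (t, x)) (r, 0) = frechet_derivative F (at (t, x)) (1, 0) * r" for r
    using linear_scale[OF linear_frechet_derivative[OF F], of r "(1, 0)"] by simp
  then have "(\<lambda>r. frechet_derivative F (at (t, x)) (r, 0)) = (*) (frechet_derivative F (at (t, x)) (1, 0))"
    by (rule ext)
  then show ?thesis
    using frechet_derivative_slice(2)[OF F] by (simp only: has_field_derivative_def)
qed

lemma smooth_on_slice:
  assumes "open S" "t \<in> I" "smooth_on (I \<times> S) F"
  shows "smooth_on S (\<lambda>x. F (t, x))"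
proof -
  have "Ck_on k S (\<lambda>x. F (t, x))" if "Ck_on k (I \<times> S) F" for k
    using that
  proof (induction k arbitrary: F)
    case 0
    then show ?case
      using assms(2) by (auto intro!: continuous_on_compose2[OF 0[simplified]] continuous_intros)
  next
    case (Suc k)
    have d: "((\<lambda>y. F (t, y)) has_derivative (\<lambda>v. frechet_derivative F (at (t, x)) (0, v))) (at x)"
      if "x \<in> S" for x
      using that Suc.prems assms(2) by (intro frechet_derivative_slice) auto
    have "Ck_on k S (\<lambda>x. frechet_derivative (\<lambda>x. F (t, x)) (at x) v)" for v
    proof (rule Ck_on_cong[OF \<open>open S\<close>])
      show "Ck_on k S (\<lambda>x. frechet_derivative F (at (t, x)) (0, v))"
        using Suc.prems by (intro Suc.IH[of "\<lambda>z. frechet_derivative F (at z) (0, v)"]) simp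
    qed (simp add: frechet_derivative_eqI[OF d])
    then show ?case using d by (auto simp: differentiable_def)
  qed
  then show ?thesis using assms(3) by (auto simp: smooth_on_def)
qed

text \<open>
  Schwarz's theorem. Two applications of the mean value theorem show that the second difference of
  \<open>f\<close> over a parallelogram with sides \<open>h v\<close> and \<open>h w\<close> is \<open>h\<^sup>2\<close> times a value of either
  mixed derivative at a point of the parallelogram. As \<open>h\<close> shrinks, continuity makes the
  two mixed derivatives agree at the corner.
\<close>

lemma second_difference_mean_value:
  fixes f :: "'a::real_normed_vector \<Rightarrow> real"
  assumes h: "h > 0" and f: "smooth_on S f"
    and in_S: "\<forall>s\<in>{0..h}. \<forall>t\<in>{0..h}. x + s *\<^sub>R v + t *\<^sub>R w \<in> S"
  obtains s t where "0 < s" "s < h" "0 < t" "t < h"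
    "f (x + h *\<^sub>R v + h *\<^sub>R w) - f (x + h *\<^sub>R v) - f (x + h *\<^sub>R w) + f x =
     h\<^sup>2 * frechet_derivative (\<lambda>y. frechet_derivative f (at y) v)
             (at (x + s *\<^sub>R v + t *\<^sub>R w)) w"
proof -
  let ?D = "\<lambda>y. frechet_derivative f (at y) v"
  have S: "x + s *\<^sub>R v + t *\<^sub>R w \<in> S" if "0 \<le> s" "s \<le> h" "0 \<le> t" "t \<le> h" for s t
    using that in_S by auto
  have Df: "(f has_derivative frechet_derivative f (at y)) (at y)" if "y \<in> S" for y
    using that f smooth_on_differentiable differentiable_has_frechet_derivative by blast
  have DD: "(?D has_derivative frechet_derivative ?D (at y)) (at y)" if "y \<in> S" for y
    using that f smooth_on_differentiable smooth_on_frechet_derivative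
      differentiable_has_frechet_derivative by blast
  have d1: "((\<lambda>s. f (x + s *\<^sub>R v + t *\<^sub>R w)) has_real_derivative ?D (x + s *\<^sub>R v + t *\<^sub>R w)) (at s)"
    if "0 \<le> s" "s \<le> h" "0 \<le> t" "t \<le> h" for s t
  proof -
    have "((\<lambda>s. x + s *\<^sub>R v + t *\<^sub>R w) has_derivative (\<lambda>r. r *\<^sub>R v)) (at s)"
      by (auto intro!: derivative_eq_intros)
    from has_derivative_compose[OF this Df[OF S[OF that]]] show ?thesis
      using linear_scale[OF has_derivative_linear[OF Df[OF S[OF that]]]]
      by (simp add: has_field_derivative_def mult_commute_abs)
  qed
  have d2: "((\<lambda>t. ?D (x + s *\<^sub>R v + t *\<^sub>R w)) has_real_derivative
      frechet_derivative ?D (at (x + s *\<^sub>R v + t *\<^sub>R w)) w) (at t)"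
    if "0 \<le> s" "s \<le> h" "0 \<le> t" "t \<le> h" for s t
  proof -
    have "((\<lambda>t. x + s *\<^sub>R v + t *\<^sub>R w) has_derivative (\<lambda>r. r *\<^sub>R w)) (at t)"
      by (auto intro!: derivative_eq_intros)
    from has_derivative_compose[OF this DD[OF S[OF that]]] show ?thesis
      using linear_scale[OF has_derivative_linear[OF DD[OF S[OF that]]]]
      by (simp add: has_field_derivative_def mult_commute_abs)
  qed
  have "\<exists>s>0. s < h \<and>
    (f (x + h *\<^sub>R v + h *\<^sub>R w) - f (x + h *\<^sub>R v + 0 *\<^sub>R w)) - (f (x + 0 *\<^sub>R v + h *\<^sub>R w) - f (x + 0 *\<^sub>R v + 0 *\<^sub>R w))
    = (h - 0) * (?D (x + s *\<^sub>R v + h *\<^sub>R w) - ?D (x + s *\<^sub>R v + 0 *\<^sub>R w))"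
    by (intro MVT2 DERIV_diff d1) (use h in auto)
  then obtain s where s: "0 < s" "s < h"
    "f (x + h *\<^sub>R v + h *\<^sub>R w) - f (x + h *\<^sub>R v) - f (x + h *\<^sub>R w) + f x =
      h * (?D (x + s *\<^sub>R v + h *\<^sub>R w) - ?D (x + s *\<^sub>R v + 0 *\<^sub>R w))"
    by auto
  have "\<exists>t>0. t < h \<and> ?D (x + s *\<^sub>R v + h *\<^sub>R w) - ?D (x + s *\<^sub>R v + 0 *\<^sub>R w)
      = (h - 0) * frechet_derivative ?D (at (x + s *\<^sub>R v + t *\<^sub>R w)) w"
    by (intro MVT2 d2) (use h s in auto)
  then obtain t where t: "0 < t" "t < h" "?D (x + s *\<^sub>R v + h *\<^sub>R w) - ?D (x + s *\<^sub>R v + 0 *\<^sub>R w)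
      = h * frechet_derivative ?D (at (x + s *\<^sub>R v + t *\<^sub>R w)) w"
    by auto
  show thesis
    using that[OF s(1,2) t(1,2)] s(3) t(3) by (simp add: power2_eq_square)
qed

lemma frechet_derivative_commute:
  fixes f :: "'a::real_normed_vector \<Rightarrow> real"
  assumes S: "open S" "x \<in> S" and f: "smooth_on S f"
  shows "frechet_derivative (\<lambda>y. frechet_derivative f (at y) v) (at x) w =
    frechet_derivative (\<lambda>y. frechet_derivative f (at y) w) (at x) v"
proof (rule ccontr)
  let ?P = "\<lambda>y. frechet_derivative (\<lambda>y. frechet_derivative f (at y) v) (at y) w"
  let ?Q = "\<lambda>y. frechet_derivative (\<lambda>y. frechet_derivative f (at y) w) (at y) v"
  assume ne: "?P x \<noteq> ?Q x"
  define e where "e = \<bar>?P x - ?Q x\<bar> / 2"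
  have e: "e > 0" using ne by (simp add: e_def)
  have "continuous_on S ?P" "continuous_on S ?Q"
    by (intro smooth_on_continuous smooth_on_frechet_derivative f)+
  then have "continuous (at x) ?P" "continuous (at x) ?Q"
    using S continuous_on_eq_continuous_at by blast+
  then obtain d1 d2 where d1: "d1 > 0" "\<And>y. dist y x < d1 \<Longrightarrow> \<bar>?P y - ?P x\<bar> < e"
    and d2: "d2 > 0" "\<And>y. dist y x < d2 \<Longrightarrow> \<bar>?Q y - ?Q x\<bar> < e"
    using e unfolding continuous_at_eps_delta dist_real_def by metis
  obtain d3 where d3: "d3 > 0" "ball x d3 \<subseteq> S"
    using S openE by blast
  define d where "d = min d1 (min d2 d3)"
  define h where "h = d / (2 * (norm v + norm w + 1))"
  have pos: "norm v + norm w + 1 > 0" by (smt (verit) norm_ge_zero)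
  have d: "d > 0" using d1 d2 d3 by (simp add: d_def)
  have h: "h > 0" using d pos by (simp add: h_def)
  have hd: "h * (norm v + norm w) < d"
  proof -
    have "h * (norm v + norm w) \<le> h * (norm v + norm w + 1)" using h by simp
    also have "\<dots> = d / 2" using pos by (simp add: h_def field_simps)
    finally show ?thesis using d by simp
  qed
  have near: "dist (x + s *\<^sub>R v + t *\<^sub>R w) x < d" if "0 \<le> s" "s \<le> h" "0 \<le> t" "t \<le> h" for s t
  proof -
    have "dist (x + s *\<^sub>R v + t *\<^sub>R w) x \<le> s * norm v + t * norm w"
      using that norm_triangle_ineq[of "s *\<^sub>R v" "t *\<^sub>R w"] by (simp add: dist_norm)
    also have "\<dots> \<le> h * (norm v + norm w)"
      using that by (simp add: distrib_left add_mono mult_right_mono)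
    finally show ?thesis using hd by simp
  qed
  have inS: "\<forall>s\<in>{0..h}. \<forall>t\<in>{0..h}. x + s *\<^sub>R v + t *\<^sub>R w \<in> S"
  proof (intro ballI)
    fix s t assume "s \<in> {0..h}" "t \<in> {0..h}"
    then show "x + s *\<^sub>R v + t *\<^sub>R w \<in> S"
      using near[of s t] d3 by (auto simp: d_def dist_commute subset_iff)
  qed
  obtain s t where st: "0 < s" "s < h" "0 < t" "t < h"
    "f (x + h *\<^sub>R v + h *\<^sub>R w) - f (x + h *\<^sub>R v) - f (x + h *\<^sub>R w) + f x =
     h\<^sup>2 * ?P (x + s *\<^sub>R v + t *\<^sub>R w)"
    using second_difference_mean_value[OF h f inS] .
  have inS': "\<forall>s\<in>{0..h}. \<forall>t\<in>{0..h}. x + s *\<^sub>R w + t *\<^sub>R v \<in> S"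
    using inS by (simp add: add.assoc add.commute[of "_ *\<^sub>R v"])
  obtain s' t' where st': "0 < s'" "s' < h" "0 < t'" "t' < h"
    "f (x + h *\<^sub>R w + h *\<^sub>R v) - f (x + h *\<^sub>R w) - f (x + h *\<^sub>R v) + f x =
     h\<^sup>2 * ?Q (x + s' *\<^sub>R w + t' *\<^sub>R v)"
    using second_difference_mean_value[OF h f inS'] .
  have "h\<^sup>2 * ?P (x + s *\<^sub>R v + t *\<^sub>R w) = h\<^sup>2 * ?Q (x + t' *\<^sub>R v + s' *\<^sub>R w)"
  proof -
    have "x + h *\<^sub>R w + h *\<^sub>R v = x + h *\<^sub>R v + h *\<^sub>R w"
      "x + s' *\<^sub>R w + t' *\<^sub>R v = x + t' *\<^sub>R v + s' *\<^sub>R w"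
      by (simp_all add: add_ac)
    with st(5) st'(5) show ?thesis by (simp only:)
  qed
  then have "?P (x + s *\<^sub>R v + t *\<^sub>R w) = ?Q (x + t' *\<^sub>R v + s' *\<^sub>R w)"
    using h by simp
  moreover have "\<bar>?P (x + s *\<^sub>R v + t *\<^sub>R w) - ?P x\<bar> < e"
    using near[of s t] st by (intro d1) (auto simp: d_def)
  moreover have "\<bar>?Q (x + t' *\<^sub>R v + s' *\<^sub>R w) - ?Q x\<bar> < e"
    using near[of t' s'] st' by (intro d2) (auto simp: d_def)
  ultimately have "\<bar>?P x - ?Q x\<bar> < e + e" by (simp only:)
  then show False by (simp add: e_def)
qed

section \<open>Evaluating wedge products and exterior derivatives\<close>

text \<open>
  Splitting index sets by membership of \<open>0\<close> unrolls the sum over shuffles of a list of known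
  length, without comparing the subsets of the index set with each other.
\<close>

lemma sum_Pow_lessThan_Suc:
  "(\<Sum>S\<in>Pow {..<Suc n}. F S) = (\<Sum>S\<in>Pow {..<n}. F (Suc ` S) + F (insert 0 (Suc ` S)))"
  for F :: "nat set \<Rightarrow> 'b::comm_monoid_add"
proof -
  let ?P = "Pow (Suc ` {..<n})"
  have P: "?P = (`) Suc ` Pow {..<n}"
    by (simp add: image_Pow_surj)
  have inj: "inj_on ((`) Suc) (Pow {..<n})" "inj_on (insert 0) ?P"
    by (auto simp: inj_on_def)
  have "(\<Sum>S\<in>Pow {..<Suc n}. F S) = (\<Sum>S\<in>?P \<union> insert 0 ` ?P. F S)"
    by (simp add: lessThan_Suc_eq_insert_0 Pow_insert)
  also have "\<dots> = (\<Sum>S\<in>?P. F S) + (\<Sum>S\<in>insert 0 ` ?P. F S)"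
    by (intro sum.union_disjoint) auto
  also have "(\<Sum>S\<in>insert 0 ` ?P. F S) = (\<Sum>S\<in>?P. F (insert 0 S))"
    by (simp add: sum.reindex[OF inj(2)])
  finally show ?thesis
    unfolding P by (simp add: sum.reindex[OF inj(1)] sum.distrib)
qed

text \<open>
  The number of inversions as a nested sum, which the simplifier evaluates for explicit \<open>S\<close>.
\<close>

lemma shuffle_sign_eq:
  assumes "S \<subseteq> {..<n}"
  shows "shuffle_sign n S = (- 1) ^ (\<Sum>i\<in>S. \<Sum>j<i. if j \<in> S then 0 else 1)"
proof -
  have fin: "finite S" using assms finite_subset by blast
  have "{(i, j). i \<in> S \<and> j \<in> {..<n} - S \<and> j < i} = (SIGMA i:S. {j. j < i \<and> j \<notin> S})"
    using assms by auto
  then have "card {(i, j). i \<in> S \<and> j \<in> {..<n} - S \<and> j < i} = (\<Sum>i\<in>S. card {j. j < i \<and> j \<notin> S})"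
    using fin by (simp add: card_SigmaI)
  also have "\<dots> = (\<Sum>i\<in>S. \<Sum>j<i. if j \<in> S then 0 else 1)"
  proof (rule sum.cong[OF refl])
    fix i
    have "{j. j < i \<and> j \<notin> S} = {j \<in> {..<i}. j \<notin> S}" by auto
    then show "card {j. j < i \<and> j \<notin> S} = (\<Sum>j<i. if j \<in> S then 0 else 1)"
      by (simp add: sum.If_cases Int_def)
  qed
  finally show ?thesis by (simp add: shuffle_sign_def)
qed

text \<open>
  The first clause of \<open>is_form\<close>. It is inherited by products and derivatives in all degrees, so it
  can be had, and extensionality (\<open>supported_eqI\<close>) applied, without knowing that they are forms.
\<close>

definition supported :: "('a, 'e) mfd \<Rightarrow> nat \<Rightarrow> ('a, 'e) form \<Rightarrow> bool" where
  "supported M k \<omega> \<longleftrightarrow>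
     (\<forall>c x vs. \<omega> c x vs \<noteq> 0 \<longrightarrow> c \<in> atlas M \<and> x \<in> cimg c \<and> length vs = k)"

lemma supportedD:
  assumes "supported M k \<omega>" "\<omega> c x vs \<noteq> 0"
  shows "c \<in> atlas M" "x \<in> cimg c" "length vs = k"
  using assms unfolding supported_def by metis+

lemma supported_vanishes:
  assumes "supported M k \<omega>"
  shows "c \<notin> atlas M \<Longrightarrow> \<omega> c x vs = 0" "x \<notin> cimg c \<Longrightarrow> \<omega> c x vs = 0"
    "length vs \<noteq> k \<Longrightarrow> \<omega> c x vs = 0"
  using assms unfolding supported_def by metis+

lemma supported_eqI:
  assumes "supported M k \<omega>" "supported M k \<eta>"
    "\<And>c x vs. c \<in> atlas M \<Longrightarrow> x \<in> cimg c \<Longrightarrow> length vs = k \<Longrightarrow> \<omega> c x vs = \<eta> c x vs"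
  shows "\<omega> = \<eta>"
proof (intro ext)
  fix c x vs
  show "\<omega> c x vs = \<eta> c x vs"
    using assms unfolding supported_def by metis
qed

lemma supported_zero [simp]: "supported M k 0"
  by (simp add: supported_def)

lemma supported_add: "supported M k \<omega> \<Longrightarrow> supported M k \<eta> \<Longrightarrow> supported M k (\<omega> + \<eta>)"
  unfolding supported_def by (metis add.left_neutral plus_fun_apply)

lemma supported_diff: "supported M k \<omega> \<Longrightarrow> supported M k \<eta> \<Longrightarrow> supported M k (\<omega> - \<eta>)"
  unfolding supported_def by (metis diff_zero minus_apply)

lemma supported_ext_d:
  assumes "supported M k \<omega>" shows "supported M (Suc k) (ext_d \<omega>)"
  unfolding supported_def
proof (intro allI impI)
  fix c x vs assume nz: "ext_d \<omega> c x vs \<noteq> 0"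
  then have x: "x \<in> cimg c" unfolding ext_d_def by meson
  have "\<exists>i<length vs. frechet_derivative (\<lambda>y. \<omega> c y (nths vs (- {i}))) (at x) (vs ! i) \<noteq> 0"
    using nz x by (fastforce simp: ext_d_def intro: sum.neutral)
  then obtain i where i: "i < length vs"
    and d: "frechet_derivative (\<lambda>y. \<omega> c y (nths vs (- {i}))) (at x) (vs ! i) \<noteq> 0" by blast
  have "(\<lambda>y. \<omega> c y (nths vs (- {i}))) \<noteq> (\<lambda>y. 0)" using d by auto
  then obtain y where y: "\<omega> c y (nths vs (- {i})) \<noteq> 0" by blast
  have "{j. j < length vs \<and> j \<in> - {i}} = {..<length vs} - {i}" by auto
  then have "length (nths vs (- {i})) = length vs - 1"
    using i by (simp add: length_nths)
  moreover have "c \<in> atlas M" "length (nths vs (- {i})) = k"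
    using supportedD[OF assms y] by auto
  ultimately show "c \<in> atlas M \<and> x \<in> cimg c \<and> length vs = Suc k" using x i by simp
qed

lemma supported_wedge:
  assumes "supported M k \<omega>" "supported M l \<eta>" shows "supported M (k + l) (\<omega> \<and>\<^sub>f \<eta>)"
  unfolding supported_def
proof (intro allI impI)
  fix c x vs assume nz: "(\<omega> \<and>\<^sub>f \<eta>) c x vs \<noteq> 0"
  then obtain S where "\<omega> c x (nths vs S) \<noteq> 0" "\<eta> c x (nths vs (- S)) \<noteq> 0"
    unfolding wedge_def by (force elim!: sum.not_neutral_contains_not_neutral)
  then have *: "c \<in> atlas M" "x \<in> cimg c" "length (nths vs S) = k" "length (nths vs (- S)) = l"
    using supportedD[OF assms(1)] supportedD[OF assms(2)] by blast+
  have "{..<length vs} = {i. i < length vs \<and> i \<in> S} \<union> {i. i < length vs \<and> i \<in> - S}" by auto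
  then have "length vs = card ({i. i < length vs \<and> i \<in> S} \<union> {i. i < length vs \<and> i \<in> - S})"
    by (metis card_lessThan)
  also have "\<dots> = k + l"
    using *(3,4) by (subst card_Un_disjoint) (auto simp: length_nths)
  finally show "c \<in> atlas M \<and> x \<in> cimg c \<and> length vs = k + l" using * by simp
qed

lemmas wedge_eval_simps = wedge_def sum_Pow_lessThan_Suc shuffle_sign_eq nths_Cons
  sum.lessThan_Suc supported_vanishes(3)

text \<open>
  Wedge products of one- and two-forms at a fixed point, with arguments given one by one. Identities
  between these are polynomial identities.
\<close>

definition alt11 :: "('v \<Rightarrow> real) \<Rightarrow> ('v \<Rightarrow> real) \<Rightarrow> 'v \<Rightarrow> 'v \<Rightarrow> real" where
  "alt11 a b p q = a p * b q - a q * b p"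

definition alt12 :: "('v \<Rightarrow> real) \<Rightarrow> ('v \<Rightarrow> 'v \<Rightarrow> real) \<Rightarrow> 'v \<Rightarrow> 'v \<Rightarrow> 'v \<Rightarrow> real" where
  "alt12 a w p q r = a p * w q r - a q * w p r + a r * w p q"

definition alt22 ::
  "('v \<Rightarrow> 'v \<Rightarrow> real) \<Rightarrow> ('v \<Rightarrow> 'v \<Rightarrow> real) \<Rightarrow> 'v \<Rightarrow> 'v \<Rightarrow> 'v \<Rightarrow> 'v \<Rightarrow> real" where
  "alt22 w z p q r s = w p q * z r s - w p r * z q s + w p s * z q r
    + w q r * z p s - w q s * z p r + w r s * z p q"

lemma wedge_0_1:
  assumes "supported M 0 h" "supported M 1 a"
  shows "(h \<and>\<^sub>f a) c x [p] = h c x [] * a c x [p]"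
  using assms by (simp add: wedge_eval_simps)

lemma wedge_1_1:
  assumes "supported M 1 a" "supported M 1 b"
  shows "(a \<and>\<^sub>f b) c x [p, q] = alt11 (\<lambda>v. a c x [v]) (\<lambda>v. b c x [v]) p q"
  using assms by (simp add: wedge_eval_simps alt11_def)

lemma wedge_1_2:
  assumes "supported M 1 a" "supported M 2 w"
  shows "(a \<and>\<^sub>f w) c x [p, q, r] = alt12 (\<lambda>v. a c x [v]) (\<lambda>v v'. w c x [v, v']) p q r"
  using assms by (simp add: wedge_eval_simps alt12_def)

lemma wedge_2_2:
  assumes "supported M 2 w" "supported M 2 z"
  shows "(w \<and>\<^sub>f z) c x [p, q, r, s] =
    alt22 (\<lambda>v v'. w c x [v, v']) (\<lambda>v v'. z c x [v, v']) p q r s"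
  using assms by (simp add: wedge_eval_simps alt22_def)

lemma ext_d_0:
  "x \<in> cimg c \<Longrightarrow> ext_d h c x [p] = frechet_derivative (\<lambda>y. h c y []) (at x) p"
  by (simp add: ext_d_def nths_Cons)

lemma ext_d_1:
  "x \<in> cimg c \<Longrightarrow> ext_d a c x [p, q] =
    frechet_derivative (\<lambda>y. a c y [q]) (at x) p - frechet_derivative (\<lambda>y. a c y [p]) (at x) q"
  by (simp add: ext_d_def nths_Cons lessThan_Suc)

lemma ext_d_2:
  "x \<in> cimg c \<Longrightarrow> ext_d w c x [p, q, r] =
    frechet_derivative (\<lambda>y. w c y [q, r]) (at x) p - frechet_derivative (\<lambda>y. w c y [p, r]) (at x) q
    + frechet_derivative (\<lambda>y. w c y [p, q]) (at x) r"
  by (simp add: ext_d_def nths_Cons lessThan_Suc)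

lemma ext_d_3:
  "x \<in> cimg c \<Longrightarrow> ext_d w c x [p, q, r, s] =
    frechet_derivative (\<lambda>y. w c y [q, r, s]) (at x) p - frechet_derivative (\<lambda>y. w c y [p, r, s]) (at x) q
    + frechet_derivative (\<lambda>y. w c y [p, q, s]) (at x) r - frechet_derivative (\<lambda>y. w c y [p, q, r]) (at x) s"
  by (simp add: ext_d_def nths_Cons lessThan_Suc)


section \<open>Algebra of alternating forms at a point\<close>

text \<open>
  If \<open>\<alpha> \<and> w = - a \<and> \<alpha> \<and> \<Gamma>\<close> then \<open>w \<and> \<alpha> \<and> \<Gamma> = - a \<and> \<alpha> \<and> \<Gamma> \<and> \<Gamma> = 0\<close>. This is used with
  \<open>\<alpha> \<and> \<Gamma> = dB\<close> and \<open>w = db\<close>.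
\<close>

lemma alt22_eq_0:
  assumes "\<And>p q r. alt12 \<alpha> w p q r = - alt12 a (alt11 \<alpha> \<Gamma>) p q r"
  shows "alt22 w (alt11 \<alpha> \<Gamma>) p q r s = 0"
proof -
  have "alt22 w (alt11 \<alpha> \<Gamma>) p q r s =
      alt12 \<alpha> w p q r * \<Gamma> s - alt12 \<alpha> w p q s * \<Gamma> r
      + alt12 \<alpha> w p r s * \<Gamma> q - alt12 \<alpha> w q r s * \<Gamma> p"
    by (simp add: alt22_def alt12_def alt11_def algebra_simps)
  also have "\<dots> = 0"
    unfolding assms by (simp add: alt12_def alt11_def algebra_simps)
  finally show ?thesis .
qed

text \<open>
  The effect on \<open>b \<and> \<beta> \<and> d\<beta>\<close> of replacing \<open>\<beta>\<close> by \<open>\<beta> + g \<alpha>\<close> and \<open>b\<close> by \<open>b + g A\<close>, where \<open>G\<close> stands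
  for \<open>dg\<close> and \<open>\<alpha> \<and> \<gamma>\<close> for \<open>d\<beta>\<close>. The last two terms are \<open>d (g \<beta>) \<and> dA\<close> and \<open>d (h A) \<and> d\<alpha>\<close> when
  \<open>h = g\<^sup>2 / 2\<close>; the identity holds for any \<open>h\<close>, as \<open>dA \<and> \<alpha> \<and> \<beta> = 0\<close>.
\<close>

lemma alt22_gauge_change:
  fixes \<alpha> \<beta> \<gamma> A b G :: "'v \<Rightarrow> real"
  assumes dA: "dA = (\<lambda>p q. alt11 A \<beta> p q + alt11 \<alpha> b p q)"
  shows "alt22 (alt11 (\<lambda>v. b v + g * A v) (\<lambda>v. \<beta> v + g * \<alpha> v))
      (\<lambda>p q. alt11 \<alpha> \<gamma> p q + alt11 G \<alpha> p q + g * alt11 \<alpha> \<beta> p q) p q r s =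
    alt22 (alt11 b \<beta>) (alt11 \<alpha> \<gamma>) p q r s
    + alt22 (\<lambda>p q. alt11 G \<beta> p q + g * alt11 \<alpha> \<gamma> p q) dA p q r s
    - alt22 (\<lambda>p q. g * alt11 G A p q + h * dA p q) (alt11 \<alpha> \<beta>) p q r s"
  unfolding dA by (simp add: alt22_def alt11_def algebra_simps)

text \<open>
  In the expansion of \<open>(A \<and> \<beta> + \<alpha> \<and> b) \<and> (\<beta> \<and> \<gamma> + \<alpha> \<and> \<delta>)\<close> only \<open>\<alpha> \<and> b \<and> \<beta> \<and> \<gamma>\<close> and
  \<open>A \<and> \<beta> \<and> \<alpha> \<and> \<delta>\<close> survive, and the latter contains \<open>\<alpha> \<and> \<beta> \<and> \<delta>\<close>.
\<close>

lemma alt22_primitive: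
  fixes \<alpha> \<beta> \<gamma> A b \<delta> :: "'v \<Rightarrow> real"
  assumes "\<And>p q r. alt12 \<alpha> (alt11 \<beta> \<delta>) p q r = 0"
  shows "alt22 (alt11 b \<beta>) (alt11 \<alpha> \<gamma>) p q r s =
    alt22 (\<lambda>p q. alt11 A \<beta> p q + alt11 \<alpha> b p q) (\<lambda>p q. alt11 \<beta> \<gamma> p q + alt11 \<alpha> \<delta> p q) p q r s"
proof -
  have "alt22 (\<lambda>p q. alt11 A \<beta> p q + alt11 \<alpha> b p q) (\<lambda>p q. alt11 \<beta> \<gamma> p q + alt11 \<alpha> \<delta> p q) p q r s
     = alt22 (alt11 b \<beta>) (alt11 \<alpha> \<gamma>) p q r s
       - (A p * alt12 \<alpha> (alt11 \<beta> \<delta>) q r s - A q * alt12 \<alpha> (alt11 \<beta> \<delta>) p r s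
        + A r * alt12 \<alpha> (alt11 \<beta> \<delta>) p q s - A s * alt12 \<alpha> (alt11 \<beta> \<delta>) p q r)"
    by (simp add: alt22_def alt12_def alt11_def algebra_simps)
  then show ?thesis unfolding assms by simp
qed

lemma alt22_vanishes:
  assumes "\<And>p q r. alt12 \<alpha> (alt11 \<beta> \<gamma>) p q r = 0"
  shows "alt22 (alt11 b \<beta>) (alt11 \<alpha> \<gamma>) p q r s = 0"
proof -
  have "alt22 (alt11 b \<beta>) (alt11 \<alpha> \<gamma>) p q r s =
     - (b p * alt12 \<alpha> (alt11 \<beta> \<gamma>) q r s - b q * alt12 \<alpha> (alt11 \<beta> \<gamma>) p r s
        + b r * alt12 \<alpha> (alt11 \<beta> \<gamma>) p q s - b s * alt12 \<alpha> (alt11 \<beta> \<gamma>) p q r)"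
    by (simp add: alt22_def alt12_def alt11_def algebra_simps)
  then show ?thesis unfolding assms by simp
qed

section \<open>Forms in charts and their transformation\<close>

lemma smooth_on_inner:
  fixes f :: "'a::real_normed_vector \<Rightarrow> 'b::real_inner"
  assumes S: "open S" and f: "smooth_on S f"
  shows "smooth_on S (\<lambda>x. f x \<bullet> e)"
    and "x \<in> S \<Longrightarrow> frechet_derivative (\<lambda>x. f x \<bullet> e) (at x) v = frechet_derivative f (at x) v \<bullet> e"
proof -
  have d: "((\<lambda>x. f x \<bullet> e) has_derivative (\<lambda>v. frechet_derivative f (at x) v \<bullet> e)) (at x)"
    if "f differentiable (at x)" for x and f :: "'a \<Rightarrow> 'b"
    using differentiable_has_frechet_derivative[OF that]
    by (rule has_derivative_inner_left)
  have "Ck_on k S (\<lambda>x. f x \<bullet> e)" if "Ck_on k S f" for k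
    using that
  proof (induction k arbitrary: f)
    case 0
    then show ?case by (auto intro: continuous_on_inner)
  next
    case (Suc k)
    have "Ck_on k S (\<lambda>x. frechet_derivative (\<lambda>x. f x \<bullet> e) (at x) v)" for v
    proof (rule Ck_on_cong[OF S])
      show "Ck_on k S (\<lambda>x. frechet_derivative f (at x) v \<bullet> e)"
        using Suc.prems by (intro Suc.IH) simp
      show "frechet_derivative f (at x) v \<bullet> e = frechet_derivative (\<lambda>x. f x \<bullet> e) (at x) v"
        if "x \<in> S" for x
        using Suc.prems that by (simp add: frechet_derivative_eqI[OF d])
    qed
    then show ?case using Suc.prems d unfolding Ck_on.simps by (blast intro: differentiableI)
  qed
  then show "smooth_on S (\<lambda>x. f x \<bullet> e)" using f by (simp add: smooth_on_def)
  show "x \<in> S \<Longrightarrow> frechet_derivative (\<lambda>x. f x \<bullet> e) (at x) v = frechet_derivative f (at x) v \<bullet> e"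
    using smooth_on_differentiable[OF f] by (simp add: frechet_derivative_eqI[OF d])
qed

lemma linear_eq_sum_Basis:
  fixes f :: "'e::euclidean_space \<Rightarrow> real"
  assumes "linear f" shows "f v = (\<Sum>e\<in>Basis. (v \<bullet> e) * f e)"
proof -
  have "f v = f (\<Sum>e\<in>Basis. (v \<bullet> e) *\<^sub>R e)" by (simp add: euclidean_representation)
  then show ?thesis using assms by (simp add: linear_sum linear_scale)
qed

text \<open>
  The domain, in the coordinates of \<open>c\<close>, of the change of coordinates from \<open>c\<close> to \<open>c'\<close>.
\<close>

definition overlap :: "('a, 'e) chart \<Rightarrow> ('a, 'e) chart \<Rightarrow> 'e set" where
  "overlap c c' = cmap c ` (cdom c \<inter> cdom c')"

abbreviation transition :: "('a, 'e) chart \<Rightarrow> ('a, 'e) chart \<Rightarrow> 'e \<Rightarrow> 'e" where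
  "transition c c' \<equiv> cmap c' \<circ> cinv c"

abbreviation Dtransition :: "('a, 'e::euclidean_space) chart \<Rightarrow> ('a, 'e) chart \<Rightarrow> 'e \<Rightarrow> 'e \<Rightarrow> 'e" where
  "Dtransition c c' y \<equiv> frechet_derivative (transition c c') (at y)"

text \<open>
  Smoothness for lists of every length: this is inherited by wedge products and exterior derivatives
  without regard to degrees, and it is all the smoothness that the Leibniz rules need.
\<close>

definition smooth_components :: "('a, 'e::euclidean_space) mfd \<Rightarrow> ('a, 'e) form \<Rightarrow> bool" where
  "smooth_components M \<omega> \<longleftrightarrow> (\<forall>c\<in>atlas M. \<forall>vs. smooth_on (cimg c) (\<lambda>x. \<omega> c x vs))"

locale mfd_calculus =
  fixes M :: "('a, 'e::euclidean_space) mfd"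
  assumes smooth_mfd: "smooth_manifold M"
begin

lemma open_cimg: "c \<in> atlas M \<Longrightarrow> open (cimg c)"
  using smooth_mfd by (simp add: smooth_manifold_def is_chart_def)

lemma cinv_cmap:
  assumes "c \<in> atlas M" "p \<in> cdom c" shows "cinv c (cmap c p) = p"
proof -
  have c: "is_chart (mtop M) c" using smooth_mfd assms by (simp add: smooth_manifold_def)
  then have "topspace (subtopology (mtop M) (cdom c)) = cdom c"
    using openin_subset by (fastforce simp: is_chart_def)
  then have "inj_on (cmap c) (cdom c)"
    using c by (metis is_chart_def homeomorphic_imp_injective_map)
  then show ?thesis using assms by (simp add: cinv_def)
qed

lemma cmap_cinv: "x \<in> cimg c \<Longrightarrow> cmap c (cinv c x) = x" "x \<in> cimg c \<Longrightarrow> cinv c x \<in> cdom c"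
  unfolding cimg_def cinv_def by (auto simp: f_inv_into_f inv_into_into)

lemma open_image_cmap:
  assumes c: "c \<in> atlas M" and U: "openin (mtop M) U"
  shows "open (cmap c ` (U \<inter> cdom c))"
proof -
  have ch: "is_chart (mtop M) c" using smooth_mfd c by (simp add: smooth_manifold_def)
  have "openin (subtopology (mtop M) (cdom c)) (U \<inter> cdom c)"
    using U by (auto simp: openin_subtopology)
  then have "openin (top_of_set (cimg c)) (cmap c ` (U \<inter> cdom c))"
    using ch homeomorphic_imp_open_map unfolding is_chart_def open_map_def by blast
  then show ?thesis
    using open_cimg[OF c] by (metis openin_open_eq)
qed

lemma open_overlap:
  assumes c: "c \<in> atlas M" and c': "c' \<in> atlas M" shows "open (overlap c c')"
proof -
  have "openin (mtop M) (cdom c')"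
    using smooth_mfd c' by (simp add: smooth_manifold_def is_chart_def)
  from open_image_cmap[OF c this] show ?thesis by (simp add: overlap_def Int_commute)
qed

lemma smooth_transition:
  "c \<in> atlas M \<Longrightarrow> c' \<in> atlas M \<Longrightarrow> smooth_on (overlap c c') (transition c c')"
  using smooth_mfd by (simp add: smooth_manifold_def overlap_def)

lemma overlap_subset: "overlap c c' \<subseteq> cimg c"
  by (auto simp: overlap_def cimg_def)

lemma transition_in_cimg:
  "c \<in> atlas M \<Longrightarrow> y \<in> overlap c c' \<Longrightarrow> transition c c' y \<in> cimg c'"
  by (auto simp: overlap_def cimg_def cinv_cmap)

lemma is_form_supported: "is_form M k \<omega> \<Longrightarrow> supported M k \<omega>"
  unfolding is_form_def supported_def by (erule conjunct1)

lemma is_form_smooth_components: "is_form M k \<omega> \<Longrightarrow> smooth_components M \<omega>"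
  unfolding smooth_components_def
proof (intro ballI allI)
  fix c vs assume *: "is_form M k \<omega>" "c \<in> atlas M"
  show "smooth_on (cimg c) (\<lambda>x. \<omega> c x vs)"
  proof (cases "length vs = k")
    case True
    with * show ?thesis unfolding is_form_def by blast
  next
    case False
    then show ?thesis
      using supported_vanishes(3)[OF is_form_supported[OF *(1)]] by simp
  qed
qed

lemma is_form_transition:
  assumes "is_form M k \<omega>" "c \<in> atlas M" "c' \<in> atlas M" "y \<in> overlap c c'" "length vs = k"
  shows "\<omega> c y vs = \<omega> c' (transition c c' y) (map (Dtransition c c' y) vs)"
proof -
  obtain p where p: "p \<in> cdom c \<inter> cdom c'" "y = cmap c p" using assms(4) by (auto simp: overlap_def)
  then have "transition c c' y = cmap c' p" using cinv_cmap[OF assms(2)] by simp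
  moreover have "\<omega> c (cmap c p) vs = \<omega> c' (cmap c' p) (map (Dtransition c c' (cmap c p)) vs)"
    using assms p(1) unfolding is_form_def by blast
  ultimately show ?thesis using p(2) by simp
qed

text \<open>
  The transformation rule stated at coordinates instead of points, so that both of its sides can be
  differentiated on the open set \<open>overlap c c'\<close>.
\<close>

lemma is_formI:
  assumes "supported M k \<omega>" "smooth_components M \<omega>"
    and "\<And>c x vs i. c \<in> atlas M \<Longrightarrow> x \<in> cimg c \<Longrightarrow> length vs = k \<Longrightarrow> i < k \<Longrightarrow>
       linear (\<lambda>v. \<omega> c x (vs[i := v]))"
    and "\<And>c x vs. c \<in> atlas M \<Longrightarrow> x \<in> cimg c \<Longrightarrow> length vs = k \<Longrightarrow> \<not> distinct vs \<Longrightarrow> \<omega> c x vs = 0"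
    and "\<And>c c' y vs. c \<in> atlas M \<Longrightarrow> c' \<in> atlas M \<Longrightarrow> y \<in> overlap c c' \<Longrightarrow> length vs = k \<Longrightarrow>
       \<omega> c y vs = \<omega> c' (transition c c' y) (map (Dtransition c c' y) vs)"
  shows "is_form M k \<omega>"
  unfolding is_form_def
proof (intro conjI ballI allI impI)
  fix c c' p and vs :: "'e list" assume *: "c \<in> atlas M" "c' \<in> atlas M" "p \<in> cdom c \<inter> cdom c'" "length vs = k"
  then have "cmap c p \<in> overlap c c'" "transition c c' (cmap c p) = cmap c' p"
    using cinv_cmap by (auto simp: overlap_def)
  with assms(5)[OF *(1,2), of "cmap c p" vs] *(4)
  show "\<omega> c (cmap c p) vs = \<omega> c' (cmap c' p) (map (Dtransition c c' (cmap c p)) vs)"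
    by simp
qed (use assms in \<open>auto simp: smooth_components_def dest: supportedD\<close>)

lemma is_form_linear:
  assumes "is_form M k \<omega>" "c \<in> atlas M" "x \<in> cimg c" "length vs = k" "i < k"
  shows "linear (\<lambda>v. \<omega> c x (vs[i := v]))"
  using assms unfolding is_form_def by blast

lemma is_form_alternating:
  assumes "is_form M k \<omega>" "c \<in> atlas M" "x \<in> cimg c" "length vs = k" "\<not> distinct vs"
  shows "\<omega> c x vs = 0"
  using assms unfolding is_form_def by blast

lemma is_form_1_linear:
  assumes "is_form M 1 \<omega>" "c \<in> atlas M" "x \<in> cimg c"
  shows "linear (\<lambda>v. \<omega> c x [v])"
  using is_form_linear[OF assms, of "[0]" 0] by simp

lemma is_form_2_linear:
  assumes "is_form M 2 \<omega>" "c \<in> atlas M" "x \<in> cimg c"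
  shows "linear (\<lambda>v. \<omega> c x [v, q])" "linear (\<lambda>v. \<omega> c x [p, v])"
  using is_form_linear[OF assms, of "[0, q]" 0] is_form_linear[OF assms, of "[p, 0]" 1] by simp_all

lemma is_form_2_swap:
  assumes "is_form M 2 \<omega>" "c \<in> atlas M" "x \<in> cimg c"
  shows "\<omega> c x [q, p] = - \<omega> c x [p, q]"
proof -
  have "\<omega> c x [p + q, p + q] = 0" "\<omega> c x [p, p] = 0" "\<omega> c x [q, q] = 0"
    by (rule is_form_alternating[OF assms]; simp)+
  moreover have "\<omega> c x [p + q, u] = \<omega> c x [p, u] + \<omega> c x [q, u]"
    "\<omega> c x [u, p + q] = \<omega> c x [u, p] + \<omega> c x [u, q]" for u
    using is_form_2_linear[OF assms] linear_add by blast+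
  ultimately show ?thesis by simp
qed

lemma is_form_1I:
  assumes "supported M 1 \<omega>" "smooth_components M \<omega>"
    and lin: "\<And>c x. c \<in> atlas M \<Longrightarrow> x \<in> cimg c \<Longrightarrow> linear (\<lambda>v. \<omega> c x [v])"
    and trans: "\<And>c c' y v. c \<in> atlas M \<Longrightarrow> c' \<in> atlas M \<Longrightarrow> y \<in> overlap c c' \<Longrightarrow>
       \<omega> c y [v] = \<omega> c' (transition c c' y) [Dtransition c c' y v]"
  shows "is_form M 1 \<omega>"
proof (rule is_formI[OF assms(1,2)])
  fix c x and vs :: "'e list" and i assume *: "c \<in> atlas M" "x \<in> cimg c" "length vs = 1" "i < (1::nat)"
  then obtain u where "vs = [u]" by (auto simp: length_Suc_conv)
  with * show "linear (\<lambda>v. \<omega> c x (vs[i := v]))" using lin by simp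
next
  fix c x and vs :: "'e list" assume *: "length vs = 1" "\<not> distinct vs"
  then show "\<omega> c x vs = 0" by (auto simp: length_Suc_conv)
next
  fix c c' y and vs :: "'e list"
  assume *: "c \<in> atlas M" "c' \<in> atlas M" "y \<in> overlap c c'" "length vs = 1"
  then obtain u where "vs = [u]" by (auto simp: length_Suc_conv)
  then show "\<omega> c y vs = \<omega> c' (transition c c' y) (map (Dtransition c c' y) vs)"
    using trans[OF *(1-3)] by simp
qed

lemma is_form_2I:
  assumes "supported M 2 \<omega>" "smooth_components M \<omega>"
    and lin: "\<And>c x p. c \<in> atlas M \<Longrightarrow> x \<in> cimg c \<Longrightarrow> linear (\<lambda>v. \<omega> c x [p, v])"
    and swap: "\<And>c x p q. c \<in> atlas M \<Longrightarrow> x \<in> cimg c \<Longrightarrow> \<omega> c x [q, p] = - \<omega> c x [p, q]"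
    and trans: "\<And>c c' y p q. c \<in> atlas M \<Longrightarrow> c' \<in> atlas M \<Longrightarrow> y \<in> overlap c c' \<Longrightarrow>
       \<omega> c y [p, q] = \<omega> c' (transition c c' y) [Dtransition c c' y p, Dtransition c c' y q]"
  shows "is_form M 2 \<omega>"
proof (rule is_formI[OF assms(1,2)])
  fix c x and vs :: "'e list" and i assume *: "c \<in> atlas M" "x \<in> cimg c" "length vs = 2" "i < (2::nat)"
  then obtain p q where pq: "vs = [p, q]" by (auto simp: length_Suc_conv numeral_2_eq_2)
  have "linear (\<lambda>v. \<omega> c x [v, q])"
    using linear_compose_neg[OF lin[OF *(1,2)]] swap[OF *(1,2), of _ q] by simp
  with * pq show "linear (\<lambda>v. \<omega> c x (vs[i := v]))"
    using lin[OF *(1,2), of p] by (auto simp: less_2_cases_iff)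
next
  fix c x and vs :: "'e list"
  assume *: "c \<in> atlas M" "x \<in> cimg c" "length vs = 2" "\<not> distinct vs"
  then obtain p where "vs = [p, p]" by (auto simp: length_Suc_conv numeral_2_eq_2)
  then show "\<omega> c x vs = 0" using swap[OF *(1,2), of p p] by simp
next
  fix c c' y and vs :: "'e list"
  assume *: "c \<in> atlas M" "c' \<in> atlas M" "y \<in> overlap c c'" "length vs = 2"
  then obtain p q where "vs = [p, q]" by (auto simp: length_Suc_conv numeral_2_eq_2)
  then show "\<omega> c y vs = \<omega> c' (transition c c' y) (map (Dtransition c c' y) vs)"
    using trans[OF *(1-3)] by simp
qed

lemma is_form_add:
  assumes "is_form M k \<omega>" "is_form M k \<eta>" shows "is_form M k (\<omega> + \<eta>)"
proof (rule is_formI)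
  show "supported M k (\<omega> + \<eta>)"
    using assms by (intro supported_add is_form_supported)
  show "smooth_components M (\<omega> + \<eta>)"
    using assms[THEN is_form_smooth_components] open_cimg
    by (auto simp: smooth_components_def intro: smooth_on_add)
  fix c c' y and vs :: "'e list"
  assume *: "c \<in> atlas M" "c' \<in> atlas M" "y \<in> overlap c c'" "length vs = k"
  show "(\<omega> + \<eta>) c y vs = (\<omega> + \<eta>) c' (transition c c' y) (map (Dtransition c c' y) vs)"
    unfolding plus_fun_apply is_form_transition[OF assms(1) *] is_form_transition[OF assms(2) *] ..
qed (use assms in \<open>simp_all add: is_form_alternating linear_compose_add is_form_linear\<close>)

lemma is_form_uminus:
  assumes "is_form M k \<omega>" shows "is_form M k (- \<omega>)"
proof (rule is_formI)
  show "supported M k (- \<omega>)"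
    using is_form_supported[OF assms] by (simp add: supported_def)
  show "smooth_components M (- \<omega>)"
    using is_form_smooth_components[OF assms] open_cimg
    by (auto simp: smooth_components_def intro: smooth_on_minus)
  fix c c' y and vs :: "'e list"
  assume *: "c \<in> atlas M" "c' \<in> atlas M" "y \<in> overlap c c'" "length vs = k"
  show "(- \<omega>) c y vs = (- \<omega>) c' (transition c c' y) (map (Dtransition c c' y) vs)"
    unfolding fun_Compl_def is_form_transition[OF assms *] ..
qed (use assms in \<open>simp_all add: is_form_alternating linear_compose_neg is_form_linear\<close>)

lemma is_form_diff: "is_form M k \<omega> \<Longrightarrow> is_form M k \<eta> \<Longrightarrow> is_form M k (\<omega> - \<eta>)"
  using is_form_add[OF _ is_form_uminus] by fastforce

lemma is_form_zero: "is_form M k 0"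
  by (rule is_formI) (auto simp: smooth_components_def linear_zero)

lemma smooth_componentsD:
  "smooth_components M \<omega> \<Longrightarrow> c \<in> atlas M \<Longrightarrow> smooth_on (cimg c) (\<lambda>x. \<omega> c x vs)"
  by (simp add: smooth_components_def)

lemma smooth_components_differentiable:
  "smooth_components M \<omega> \<Longrightarrow> c \<in> atlas M \<Longrightarrow> x \<in> cimg c \<Longrightarrow> (\<lambda>x. \<omega> c x vs) differentiable (at x)"
  using smooth_componentsD smooth_on_differentiable by blast

lemma smooth_components_wedge:
  "smooth_components M \<omega> \<Longrightarrow> smooth_components M \<eta> \<Longrightarrow> smooth_components M (\<omega> \<and>\<^sub>f \<eta>)"
  unfolding smooth_components_def wedge_def
  by (auto intro!: smooth_on_sum smooth_on_mult open_cimg)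

lemma smooth_components_ext_d:
  assumes "smooth_components M \<omega>" shows "smooth_components M (ext_d \<omega>)"
  unfolding smooth_components_def
proof (intro ballI allI)
  fix c vs assume c: "c \<in> atlas M"
  have "smooth_on (cimg c) (\<lambda>x. \<Sum>i<length vs. (- 1) ^ i *
            frechet_derivative (\<lambda>y. \<omega> c y (nths vs (- {i}))) (at x) (vs ! i))"
    using assms c unfolding smooth_components_def
    by (intro smooth_on_sum smooth_on_mult open_cimg smooth_on_const smooth_on_frechet_derivative) auto
  then show "smooth_on (cimg c) (\<lambda>x. ext_d \<omega> c x vs)"
    by (rule smooth_on_cong[OF open_cimg[OF c], rotated]) (simp add: ext_d_def)
qed

lemma ext_d_add:
  assumes "smooth_components M \<omega>" "smooth_components M \<eta>" "c \<in> atlas M" "x \<in> cimg c"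
  shows "ext_d (\<omega> + \<eta>) c x vs = ext_d \<omega> c x vs + ext_d \<eta> c x vs"
proof -
  have "frechet_derivative (\<lambda>y. \<omega> c y us + \<eta> c y us) (at x) v =
    frechet_derivative (\<lambda>y. \<omega> c y us) (at x) v + frechet_derivative (\<lambda>y. \<eta> c y us) (at x) v" for us v
    using assms
    by (subst frechet_derivative_eqI[OF has_derivative_add])
       (auto intro!: differentiable_has_frechet_derivative smooth_components_differentiable)
  then show ?thesis
    using assms(4) by (simp add: ext_d_def algebra_simps sum.distrib)
qed

lemma ext_d_diff:
  assumes "smooth_components M \<omega>" "smooth_components M \<eta>" "c \<in> atlas M" "x \<in> cimg c"
  shows "ext_d (\<omega> - \<eta>) c x vs = ext_d \<omega> c x vs - ext_d \<eta> c x vs"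
proof -
  have "frechet_derivative (\<lambda>y. \<omega> c y us - \<eta> c y us) (at x) v =
    frechet_derivative (\<lambda>y. \<omega> c y us) (at x) v - frechet_derivative (\<lambda>y. \<eta> c y us) (at x) v" for us v
    using assms
    by (subst frechet_derivative_eqI[OF has_derivative_diff])
       (auto intro!: differentiable_has_frechet_derivative smooth_components_differentiable)
  then show ?thesis
    using assms(4) by (simp add: ext_d_def right_diff_distrib sum_subtractf)
qed


section \<open>Leibniz rules and invariance of the exterior derivative\<close>

text \<open>
  \<open>d \<circ> d = 0\<close> in degrees zero and one is Schwarz's theorem for the components.
\<close>

lemma ext_d_ext_d_0:
  assumes h: "smooth_components M h" and c: "c \<in> atlas M" and x: "x \<in> cimg c"
  shows "ext_d (ext_d h) c x [p, q] = 0"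
proof -
  have "frechet_derivative (\<lambda>y. ext_d h c y [q]) (at x) p =
      frechet_derivative (\<lambda>y. frechet_derivative (\<lambda>y. h c y []) (at y) q) (at x) p" for p q
    by (rule arg_cong[where f = "\<lambda>D. D p"], rule frechet_derivative_cong_open[OF open_cimg[OF c] x])
       (simp add: ext_d_0)
  then show ?thesis
    using frechet_derivative_commute[OF open_cimg[OF c] x smooth_componentsD[OF h c]]
    by (simp add: ext_d_1[OF x])
qed

lemma ext_d_ext_d_1:
  assumes a: "smooth_components M a" and c: "c \<in> atlas M" and x: "x \<in> cimg c"
  shows "ext_d (ext_d a) c x [p, q, r] = 0"
proof -
  let ?D = "\<lambda>p q r. frechet_derivative (\<lambda>y. frechet_derivative (\<lambda>y. a c y [r]) (at y) q) (at x) p"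
  have "frechet_derivative (\<lambda>y. ext_d a c y [q, r]) (at x) p = ?D p q r - ?D p r q" for p q r
  proof -
    have "frechet_derivative (\<lambda>y. ext_d a c y [q, r]) (at x) p =
      frechet_derivative (\<lambda>y. frechet_derivative (\<lambda>y. a c y [r]) (at y) q
         - frechet_derivative (\<lambda>y. a c y [q]) (at y) r) (at x) p"
      by (rule arg_cong[where f = "\<lambda>D. D p"], rule frechet_derivative_cong_open[OF open_cimg[OF c] x])
         (simp add: ext_d_1)
    also have "\<dots> = ?D p q r - ?D p r q"
      by (subst frechet_derivative_eqI[OF has_derivative_diff])
        (auto intro!: differentiable_has_frechet_derivative smooth_on_differentiable[OF _ x]
           smooth_on_frechet_derivative smooth_componentsD[OF a c])
    finally show ?thesis .
  qed
  moreover have "?D p q r = ?D q p r" for p q r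
    by (rule frechet_derivative_commute[OF open_cimg[OF c] x smooth_componentsD[OF a c]])
  ultimately show ?thesis by (simp add: ext_d_2[OF x])
qed

lemma ext_d_wedge_0_1:
  assumes "supported M 0 h" "supported M 1 a" "smooth_components M h" "smooth_components M a"
    and c: "c \<in> atlas M" and x: "x \<in> cimg c"
  shows "ext_d (h \<and>\<^sub>f a) c x [p, q] =
    alt11 (\<lambda>v. ext_d h c x [v]) (\<lambda>v. a c x [v]) p q + h c x [] * ext_d a c x [p, q]"
  using smooth_components_differentiable[OF assms(3) c x] smooth_components_differentiable[OF assms(4) c x]
  by (simp add: ext_d_1[OF x] wedge_0_1[OF assms(1,2)] frechet_derivative_mult ext_d_0[OF x] alt11_def
      algebra_simps)

lemma frechet_derivative_wedge_1_1:
  assumes "supported M 1 a" "supported M 1 b" "smooth_components M a" "smooth_components M b"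
    and c: "c \<in> atlas M" and x: "x \<in> cimg c"
  shows "frechet_derivative (\<lambda>y. (a \<and>\<^sub>f b) c y [q, r]) (at x) p =
    alt11 (\<lambda>v. frechet_derivative (\<lambda>y. a c y [v]) (at x) p) (\<lambda>v. b c x [v]) q r
    + alt11 (\<lambda>v. a c x [v]) (\<lambda>v. frechet_derivative (\<lambda>y. b c y [v]) (at x) p) q r"
proof -
  note d = smooth_components_differentiable[OF assms(3) c x] smooth_components_differentiable[OF assms(4) c x]
  have "frechet_derivative (\<lambda>y. a c y [q] * b c y [r] - a c y [r] * b c y [q]) (at x) p =
     frechet_derivative (\<lambda>y. a c y [q] * b c y [r]) (at x) p
     - frechet_derivative (\<lambda>y. a c y [r] * b c y [q]) (at x) p"
    by (subst frechet_derivative_eqI[OF has_derivative_diff])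
       (auto intro!: differentiable_has_frechet_derivative differentiable_mult d)
  then show ?thesis
    by (simp add: wedge_1_1[OF assms(1,2)] alt11_def frechet_derivative_mult d)
qed

lemma ext_d_wedge_1_1:
  assumes "supported M 1 a" "supported M 1 b" "smooth_components M a" "smooth_components M b"
    and c: "c \<in> atlas M" and x: "x \<in> cimg c"
  shows "ext_d (a \<and>\<^sub>f b) c x [p, q, r] =
    alt12 (\<lambda>v. b c x [v]) (\<lambda>v w. ext_d a c x [v, w]) p q r
    - alt12 (\<lambda>v. a c x [v]) (\<lambda>v w. ext_d b c x [v, w]) p q r"
  by (simp add: ext_d_2[OF x] frechet_derivative_wedge_1_1[OF assms] ext_d_1[OF x] alt11_def alt12_def
      algebra_simps)

text \<open>
  The term \<open>a \<and> d (db)\<close> of the Leibniz rule drops out. Grouping the derivatives of \<open>db\<close> by the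
  argument that is fed to \<open>a\<close> exhibits it as a combination of values of \<open>d (db)\<close>.
\<close>

lemma ext_d_wedge_1_ext_d:
  assumes a: "supported M 1 a" "smooth_components M a"
    and b: "supported M 1 b" "smooth_components M b"
    and c: "c \<in> atlas M" and x: "x \<in> cimg c"
  shows "ext_d (a \<and>\<^sub>f ext_d b) c x [p, q, r, s] =
    alt22 (\<lambda>v w. ext_d a c x [v, w]) (\<lambda>v w. ext_d b c x [v, w]) p q r s"
proof -
  let ?w = "ext_d b"
  let ?Da = "\<lambda>p v. frechet_derivative (\<lambda>y. a c y [v]) (at x) p"
  let ?Dw = "\<lambda>p v u. frechet_derivative (\<lambda>y. ?w c y [v, u]) (at x) p"
  have w: "supported M 2 ?w" "smooth_components M ?w"
    using supported_ext_d[OF b(1)] smooth_components_ext_d[OF b(2)] by (simp_all add: numeral_2_eq_2)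
  note d = smooth_components_differentiable[OF a(2) c x] smooth_components_differentiable[OF w(2) c x]
  have D: "frechet_derivative (\<lambda>y. (a \<and>\<^sub>f ?w) c y [p, q, r]) (at x) u =
      alt12 (?Da u) (\<lambda>v w. ?w c x [v, w]) p q r + alt12 (\<lambda>v. a c x [v]) (?Dw u) p q r" for p q r u
  proof -
    have "frechet_derivative (\<lambda>y. (a \<and>\<^sub>f ?w) c y [p, q, r]) (at x) u =
      frechet_derivative (\<lambda>y. a c y [p] * ?w c y [q, r]) (at x) u
      - frechet_derivative (\<lambda>y. a c y [q] * ?w c y [p, r]) (at x) u
      + frechet_derivative (\<lambda>y. a c y [r] * ?w c y [p, q]) (at x) u"
      unfolding wedge_1_2[OF a(1) w(1)] alt12_def
      by (subst frechet_derivative_eqI[OF has_derivative_add[OF has_derivative_diff]])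
         (auto intro!: differentiable_has_frechet_derivative differentiable_mult d)
    then show ?thesis by (simp add: alt12_def frechet_derivative_mult d)
  qed
  have dw: "?Dw p q r - ?Dw q p r + ?Dw r p q = 0" for p q r
    using ext_d_ext_d_1[OF b(2) c x, of p q r] by (simp add: ext_d_2[OF x])
  have "ext_d (a \<and>\<^sub>f ?w) c x [p, q, r, s] =
      alt22 (\<lambda>v w. ext_d a c x [v, w]) (\<lambda>v w. ?w c x [v, w]) p q r s
      - (a c x [p] * (?Dw q r s - ?Dw r q s + ?Dw s q r)
       - a c x [q] * (?Dw p r s - ?Dw r p s + ?Dw s p r)
       + a c x [r] * (?Dw p q s - ?Dw q p s + ?Dw s p q)
       - a c x [s] * (?Dw p q r - ?Dw q p r + ?Dw r p q))"
    by (simp add: ext_d_3[OF x] D ext_d_1[OF x, of a] alt12_def alt22_def algebra_simps)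
  then show ?thesis unfolding dw by simp
qed

lemma is_form_wedge_0_1:
  assumes h: "is_form M 0 h" and a: "is_form M 1 a" shows "is_form M 1 (h \<and>\<^sub>f a)"
proof (rule is_form_1I)
  note s = is_form_supported[OF h] is_form_supported[OF a]
  show "supported M 1 (h \<and>\<^sub>f a)" using supported_wedge[OF s] by simp
  show "smooth_components M (h \<and>\<^sub>f a)"
    using h a by (intro smooth_components_wedge is_form_smooth_components)
  show "linear (\<lambda>v. (h \<and>\<^sub>f a) c x [v])" if "c \<in> atlas M" "x \<in> cimg c" for c x
    unfolding wedge_0_1[OF s] using linear_compose_scale_right[OF is_form_1_linear[OF a that], of "h c x []"]
    by simp
  show "(h \<and>\<^sub>f a) c y [v] = (h \<and>\<^sub>f a) c' (transition c c' y) [Dtransition c c' y v]"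
    if "c \<in> atlas M" "c' \<in> atlas M" "y \<in> overlap c c'" for c c' y v
    unfolding wedge_0_1[OF s]
    using is_form_transition[OF h that, of "[]"] is_form_transition[OF a that, of "[v]"] by simp
qed

lemma is_form_ext_d_0:
  assumes h: "is_form M 0 h" shows "is_form M 1 (ext_d h)"
proof (rule is_form_1I)
  show "supported M 1 (ext_d h)" using supported_ext_d[OF is_form_supported[OF h]] by simp
  show "smooth_components M (ext_d h)"
    by (intro smooth_components_ext_d is_form_smooth_components[OF h])
  show "linear (\<lambda>v. ext_d h c x [v])" if "c \<in> atlas M" "x \<in> cimg c" for c x
    using linear_frechet_derivative[OF smooth_components_differentiable
        [OF is_form_smooth_components[OF h] that, of "[]"]] that
    by (simp add: ext_d_0)
  show "ext_d h c y [v] = ext_d h c' (transition c c' y) [Dtransition c c' y v]"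
    if *: "c \<in> atlas M" "c' \<in> atlas M" "y \<in> overlap c c'" for c c' y v
  proof -
    let ?t = "transition c c'"
    have y: "y \<in> cimg c" "?t y \<in> cimg c'" using subsetD[OF overlap_subset *(3)] transition_in_cimg[OF *(1,3)] by blast+
    have Dt: "(?t has_derivative Dtransition c c' y) (at y)"
      by (rule differentiable_has_frechet_derivative[OF smooth_on_differentiable
            [OF smooth_transition[OF *(1,2)] *(3)]])
    have Dh: "((\<lambda>y. h c' y []) has_derivative frechet_derivative (\<lambda>y. h c' y []) (at (?t y))) (at (?t y))"
      by (rule differentiable_has_frechet_derivative[OF smooth_components_differentiable
            [OF is_form_smooth_components[OF h] *(2) y(2)]])
    have "frechet_derivative (\<lambda>y. h c y []) (at y) = frechet_derivative (\<lambda>y. h c' (?t y) []) (at y)"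
      using is_form_transition[OF h *(1,2), of _ "[]"]
      by (intro frechet_derivative_cong_open[OF open_overlap[OF *(1,2)] *(3)]) simp
    also have "\<dots> = (\<lambda>v. frechet_derivative (\<lambda>y. h c' y []) (at (?t y)) (Dtransition c c' y v))"
      by (rule frechet_derivative_eqI[OF has_derivative_compose[OF Dt Dh]])
    finally show ?thesis using y by (simp add: ext_d_0)
  qed
qed

text \<open>
  Differentiating the transformation rule of a one-form produces the expected term and one with the
  second derivative of the change of coordinates; the latter is symmetric in the two arguments and
  cancels in the exterior derivative.
\<close>

lemma ext_d_transition:
  assumes a: "is_form M 1 a" and *: "c \<in> atlas M" "c' \<in> atlas M" "y \<in> overlap c c'"
  shows "ext_d a c y [p, q] =
    ext_d a c' (transition c c' y) [Dtransition c c' y p, Dtransition c c' y q]"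
proof -
  let ?t = "transition c c'" and ?S = "overlap c c'"
  let ?T = "\<lambda>e z. ?t z \<bullet> e"
  have S: "open ?S" by (rule open_overlap[OF *(1,2)])
  have in_img: "z \<in> cimg c" "?t z \<in> cimg c'" if "z \<in> ?S" for z
    using subsetD[OF overlap_subset that] transition_in_cimg[OF *(1) that] by blast+
  have t: "smooth_on ?S ?t" by (rule smooth_transition[OF *(1,2)])
  have T: "smooth_on ?S (?T e)" for e by (rule smooth_on_inner[OF S t])
  have DT: "Dtransition c c' z v \<bullet> e = frechet_derivative (?T e) (at z) v" if "z \<in> ?S" for z v e
    using smooth_on_inner(2)[OF S t that] by simp
  let ?A = "\<lambda>e w. frechet_derivative (\<lambda>z. a c' z [e]) (at (?t y)) w"
  have da: "(\<lambda>z. a c' z [v]) differentiable (at (?t y))" for v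
    using in_img[OF *(3)] by (intro smooth_components_differentiable is_form_smooth_components[OF a] *)
  have Dt: "(?t has_derivative Dtransition c c' y) (at y)"
    using smooth_on_differentiable[OF t *(3)] by (rule differentiable_has_frechet_derivative)
  have Da: "((\<lambda>z. a c' (?t z) [e]) has_derivative (\<lambda>p. ?A e (Dtransition c c' y p))) (at y)" for e
    by (rule has_derivative_compose[OF Dt differentiable_has_frechet_derivative[OF da]])
  have A_linear: "?A v w = (\<Sum>e\<in>Basis. (v \<bullet> e) * ?A e w)" for v w
  proof -
    have "frechet_derivative (\<lambda>z. a c' z [v]) (at (?t y)) =
        frechet_derivative (\<lambda>z. \<Sum>e\<in>Basis. (v \<bullet> e) * a c' z [e]) (at (?t y))"
      using linear_eq_sum_Basis[OF is_form_1_linear[OF a *(2)]]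
      by (intro frechet_derivative_cong_open[OF open_cimg[OF *(2)] in_img(2)[OF *(3)]]) blast
    also have "\<dots> = (\<lambda>w. \<Sum>e\<in>Basis. (v \<bullet> e) * ?A e w)"
      by (intro frechet_derivative_eqI has_derivative_sum has_derivative_mult_right
            differentiable_has_frechet_derivative da)
    finally show ?thesis by simp
  qed
  have D: "frechet_derivative (\<lambda>z. a c z [q]) (at y) p =
      ?A (Dtransition c c' y q) (Dtransition c c' y p) +
      (\<Sum>e\<in>Basis. frechet_derivative (\<lambda>z. frechet_derivative (?T e) (at z) q) (at y) p * a c' (?t y) [e])"
    for p q
  proof -
    have "a c z [q] = (\<Sum>e\<in>Basis. frechet_derivative (?T e) (at z) q * a c' (?t z) [e])" if z: "z \<in> ?S" for z
    proof -
      have "a c z [q] = a c' (?t z) [Dtransition c c' z q]"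
        using is_form_transition[OF a *(1,2) z, of "[q]"] by simp
      also have "\<dots> = (\<Sum>e\<in>Basis. (Dtransition c c' z q \<bullet> e) * a c' (?t z) [e])"
        by (rule linear_eq_sum_Basis[OF is_form_1_linear[OF a *(2) in_img(2)[OF z]]])
      finally show ?thesis unfolding DT[OF z] .
    qed
    then have "frechet_derivative (\<lambda>z. a c z [q]) (at y) =
       frechet_derivative (\<lambda>z. \<Sum>e\<in>Basis. frechet_derivative (?T e) (at z) q * a c' (?t z) [e]) (at y)"
      by (intro frechet_derivative_cong_open[OF S *(3)])
    also have "\<dots> = (\<lambda>p. \<Sum>e\<in>Basis. frechet_derivative (?T e) (at y) q * ?A e (Dtransition c c' y p)
        + frechet_derivative (\<lambda>z. frechet_derivative (?T e) (at z) q) (at y) p * a c' (?t y) [e])"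
      by (intro frechet_derivative_eqI has_derivative_sum has_derivative_mult
          Da differentiable_has_frechet_derivative
          smooth_on_differentiable[OF smooth_on_frechet_derivative[OF T]] *)
    finally show ?thesis
      unfolding A_linear[of "Dtransition c c' y q"] DT[OF *(3)] by (simp only: sum.distrib)
  qed
  have "frechet_derivative (\<lambda>z. frechet_derivative (?T e) (at z) q) (at y) p =
    frechet_derivative (\<lambda>z. frechet_derivative (?T e) (at z) p) (at y) q" for e
    by (rule frechet_derivative_commute[OF S *(3) T])
  then show ?thesis
    using in_img[OF *(3)] by (simp add: ext_d_1 D)
qed

lemma is_form_ext_d_1:
  assumes a: "is_form M 1 a" shows "is_form M 2 (ext_d a)"
proof (rule is_form_2I)
  have sm: "smooth_components M a" by (rule is_form_smooth_components[OF a])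
  show "supported M 2 (ext_d a)"
    using supported_ext_d[OF is_form_supported[OF a]] by (simp add: numeral_2_eq_2)
  show "smooth_components M (ext_d a)" by (rule smooth_components_ext_d[OF sm])
  show "ext_d a c x [q, p] = - ext_d a c x [p, q]" if "x \<in> cimg c" for c x p q
    using that by (simp add: ext_d_1)
  show "linear (\<lambda>v. ext_d a c x [p, v])" if c: "c \<in> atlas M" and x: "x \<in> cimg c" for c x p
  proof -
    note d = smooth_components_differentiable[OF sm c x]
    have "frechet_derivative (\<lambda>y. a c y [v + w]) (at x) p =
        frechet_derivative (\<lambda>y. a c y [v]) (at x) p + frechet_derivative (\<lambda>y. a c y [w]) (at x) p" for v w
    proof -
      have "frechet_derivative (\<lambda>y. a c y [v + w]) (at x) =
          frechet_derivative (\<lambda>y. a c y [v] + a c y [w]) (at x)"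
        using is_form_1_linear[OF a c] linear_add
        by (intro frechet_derivative_cong_open[OF open_cimg[OF c] x]) blast
      also have "\<dots> = (\<lambda>p. frechet_derivative (\<lambda>y. a c y [v]) (at x) p
          + frechet_derivative (\<lambda>y. a c y [w]) (at x) p)"
        by (intro frechet_derivative_eqI has_derivative_add differentiable_has_frechet_derivative d)
      finally show ?thesis by simp
    qed
    moreover have "frechet_derivative (\<lambda>y. a c y [r *\<^sub>R v]) (at x) p =
        r * frechet_derivative (\<lambda>y. a c y [v]) (at x) p" for r v
    proof -
      have "frechet_derivative (\<lambda>y. a c y [r *\<^sub>R v]) (at x) =
          frechet_derivative (\<lambda>y. r * a c y [v]) (at x)"
        using linear_scale[OF is_form_1_linear[OF a c]]
        by (intro frechet_derivative_cong_open[OF open_cimg[OF c] x]) simp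
      also have "\<dots> = (\<lambda>p. r * frechet_derivative (\<lambda>y. a c y [v]) (at x) p)"
        by (intro frechet_derivative_eqI has_derivative_mult_right differentiable_has_frechet_derivative d)
      finally show ?thesis by simp
    qed
    moreover have "linear (frechet_derivative (\<lambda>y. a c y [p]) (at x))"
      by (rule linear_frechet_derivative[OF d])
    ultimately show ?thesis
      by (intro linearI) (simp_all add: ext_d_1[OF x] linear_add linear_scale algebra_simps)
  qed
  show "ext_d a c y [p, q] = ext_d a c' (transition c c' y) [Dtransition c c' y p, Dtransition c c' y q]"
    if "c \<in> atlas M" "c' \<in> atlas M" "y \<in> overlap c c'" for c c' y p q
    by (rule ext_d_transition[OF a that])
qed

lemma is_form_wedge_1_2:
  assumes a: "is_form M 1 a" and w: "is_form M 2 w" shows "is_form M 3 (a \<and>\<^sub>f w)"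
proof (rule is_formI)
  note s = is_form_supported[OF a] is_form_supported[OF w]
  show "supported M 3 (a \<and>\<^sub>f w)" using supported_wedge[OF s] by (simp add: numeral_3_eq_3)
  show "smooth_components M (a \<and>\<^sub>f w)"
    using a w by (intro smooth_components_wedge is_form_smooth_components)
  have len3: "\<exists>p q r. vs = [p, q, r]" if "length vs = 3" for vs :: "'e list"
    using that by (auto simp: length_Suc_conv numeral_3_eq_3)
  fix c x and vs :: "'e list" assume *: "c \<in> atlas M" "x \<in> cimg c" and "length vs = 3"
  then obtain p q r where vs: "vs = [p, q, r]" using len3 by blast
  note la = is_form_1_linear[OF a *] and lw = is_form_2_linear[OF w *]
  show "linear (\<lambda>v. (a \<and>\<^sub>f w) c x (vs[i := v]))" if "i < 3" for i
  proof -
    from that consider "i = 0" | "i = 1" | "i = 2" by linarith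
    then show ?thesis
      by cases (auto simp: vs numeral_2_eq_2 wedge_1_2[OF s] alt12_def intro!: linearI;
        simp add: linear_add[OF la] linear_add[OF lw(1)] linear_add[OF lw(2)]
          linear_scale[OF la] linear_scale[OF lw(1)] linear_scale[OF lw(2)] algebra_simps)+
  qed
  show "(a \<and>\<^sub>f w) c x vs = 0" if "\<not> distinct vs"
  proof -
    have "w c x [v, v] = 0" for v using is_form_2_swap[OF w *, of v v] by simp
    then show ?thesis
      using that is_form_2_swap[OF w *, of q p] by (auto simp: vs wedge_1_2[OF s] alt12_def)
  qed
next
  note s = is_form_supported[OF a] is_form_supported[OF w]
  fix c c' y and vs :: "'e list"
  assume *: "c \<in> atlas M" "c' \<in> atlas M" "y \<in> overlap c c'" and "length vs = 3"
  then obtain p q r where vs: "vs = [p, q, r]"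
    by (auto simp: length_Suc_conv numeral_3_eq_3)
  have "a c y [v] = a c' (transition c c' y) [Dtransition c c' y v]"
    "w c y [v, v'] = w c' (transition c c' y) [Dtransition c c' y v, Dtransition c c' y v']" for v v'
    using is_form_transition[OF a *, of "[v]"] is_form_transition[OF w *, of "[v, v']"] by simp_all
  then show "(a \<and>\<^sub>f w) c y vs = (a \<and>\<^sub>f w) c' (transition c c' y) (map (Dtransition c c' y) vs)"
    by (simp only: vs list.map wedge_1_2[OF s] alt12_def)
qed


section \<open>Families of forms\<close>

text \<open>
  The components of a family, regarded as functions \<open>F\<close> on the product of the parameter interval
  and the chart image, with their two kinds of derivatives as directional derivatives of \<open>F\<close>.
\<close>

lemma form_family_slice:
  fixes v :: 'e
  assumes fam: "smooth_form_family M 1 \<epsilon> \<omega>" and t: "t \<in> {-\<epsilon><..<\<epsilon>}"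
    and c: "c \<in> atlas M" and x: "x \<in> cimg c"
  defines "F \<equiv> \<lambda>z. \<omega> (fst z) c (snd z) [v]"
  shows "form_dot \<omega> t c x [v] = frechet_derivative F (at (t, x)) (1, 0)"
    and "((\<lambda>s. \<omega> s c x [v]) has_real_derivative form_dot \<omega> t c x [v]) (at t)"
    and "frechet_derivative (\<lambda>y. \<omega> t c y [v]) (at x) p = frechet_derivative F (at (t, x)) (0, p)"
    and "smooth_on ({-\<epsilon><..<\<epsilon>} \<times> cimg c) F"
proof -
  show F: "smooth_on ({-\<epsilon><..<\<epsilon>} \<times> cimg c) F"
    using fam c unfolding smooth_form_family_def F_def case_prod_beta by simp
  have diff: "F differentiable (at (t, x))"
    using F t x by (intro smooth_on_differentiable[OF F]) auto
  have D: "((\<lambda>s. \<omega> s c x [v]) has_real_derivative frechet_derivative F (at (t, x)) (1, 0)) (at t)"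
    using DERIV_slice[OF diff] by (simp only: F_def fst_conv snd_conv)
  then show dot: "form_dot \<omega> t c x [v] = frechet_derivative F (at (t, x)) (1, 0)"
    by (simp add: form_dot_def DERIV_imp_deriv)
  show "((\<lambda>s. \<omega> s c x [v]) has_real_derivative form_dot \<omega> t c x [v]) (at t)"
    using D dot by simp
  show "frechet_derivative (\<lambda>y. \<omega> t c y [v]) (at x) p = frechet_derivative F (at (t, x)) (0, p)"
    using frechet_derivative_eqI[OF frechet_derivative_slice(1)[OF diff]] by (simp add: F_def)
qed

lemma is_form_form_dot:
  assumes fam: "smooth_form_family M 1 \<epsilon> \<omega>" and t: "t \<in> {-\<epsilon><..<\<epsilon>}"
  shows "is_form M 1 (form_dot \<omega> t)"
proof (rule is_form_1I)
  have form: "is_form M 1 (\<omega> s)" if "s \<in> {-\<epsilon><..<\<epsilon>}" for s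
    using fam that by (simp add: smooth_form_family_def)
  have deriv_cong: "deriv f t = deriv g t" if "\<And>s. s \<in> {-\<epsilon><..<\<epsilon>} \<Longrightarrow> f s = g s" for f g :: "real \<Rightarrow> real"
  proof (rule deriv_cong_ev[OF _ refl])
    show "\<forall>\<^sub>F s in nhds t. f s = g s"
      using eventually_nhds_in_open[OF _ t] that by (auto elim: eventually_mono)
  qed
  show supp: "supported M 1 (form_dot \<omega> t)"
    unfolding supported_def
  proof (intro allI impI)
    fix c x vs assume "form_dot \<omega> t c x vs \<noteq> 0"
    then have "\<exists>s\<in>{-\<epsilon><..<\<epsilon>}. \<omega> s c x vs \<noteq> 0"
      using deriv_cong[of "\<lambda>s. \<omega> s c x vs" "\<lambda>s. 0"] unfolding form_dot_def deriv_const by blast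
    then show "c \<in> atlas M \<and> x \<in> cimg c \<and> length vs = 1"
      using supportedD[OF is_form_supported[OF form]] by blast
  qed
  show "smooth_components M (form_dot \<omega> t)"
    unfolding smooth_components_def
  proof (intro ballI allI)
    fix c vs assume c: "c \<in> atlas M"
    show "smooth_on (cimg c) (\<lambda>x. form_dot \<omega> t c x vs)"
    proof (cases "length vs = 1")
      case True
      then obtain v where v: "vs = [v]" by (auto simp: length_Suc_conv)
      let ?F = "\<lambda>z. \<omega> (fst z) c (snd z) [v]"
      have "smooth_on ({-\<epsilon><..<\<epsilon>} \<times> cimg c) ?F"
        using fam c unfolding smooth_form_family_def case_prod_beta by simp
      then have "smooth_on (cimg c) (\<lambda>x. frechet_derivative ?F (at (t, x)) (1, 0))"
        by (intro smooth_on_slice[OF open_cimg[OF c] t] smooth_on_frechet_derivative)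
      then show ?thesis
        unfolding v by (rule smooth_on_cong[OF open_cimg[OF c], rotated])
          (simp add: form_family_slice(1)[OF fam t c])
    next
      case False
      then show ?thesis using supported_vanishes(3)[OF supp] by simp
    qed
  qed
  show "linear (\<lambda>v. form_dot \<omega> t c x [v])" if c: "c \<in> atlas M" and x: "x \<in> cimg c" for c x
  proof (rule linearI)
    note D = form_family_slice(2)[OF fam t c x]
    note lin = is_form_1_linear[OF form c x]
    fix v w r
    have "form_dot \<omega> t c x [v + w] = deriv (\<lambda>s. \<omega> s c x [v] + \<omega> s c x [w]) t"
      unfolding form_dot_def using linear_add[OF lin] by (rule deriv_cong)
    also have "\<dots> = form_dot \<omega> t c x [v] + form_dot \<omega> t c x [w]"
      by (rule DERIV_imp_deriv[OF DERIV_add[OF D D]])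
    finally show "form_dot \<omega> t c x [v + w] = form_dot \<omega> t c x [v] + form_dot \<omega> t c x [w]" .
    have "form_dot \<omega> t c x [r *\<^sub>R v] = deriv (\<lambda>s. r * \<omega> s c x [v]) t"
      unfolding form_dot_def using linear_scale[OF lin] by (intro deriv_cong) simp
    also have "\<dots> = r * form_dot \<omega> t c x [v]"
      by (rule DERIV_imp_deriv[OF DERIV_cmult[OF D]])
    finally show "form_dot \<omega> t c x [r *\<^sub>R v] = r *\<^sub>R form_dot \<omega> t c x [v]" by simp
  qed
  show "form_dot \<omega> t c y [v] = form_dot \<omega> t c' (transition c c' y) [Dtransition c c' y v]"
    if "c \<in> atlas M" "c' \<in> atlas M" "y \<in> overlap c c'" for c c' y v
    unfolding form_dot_def
    using is_form_transition[OF form that, of _ "[v]"] by (intro deriv_cong) simp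
qed

text \<open>
  Exterior derivative and derivative in the parameter commute, by Schwarz's theorem on the product.
\<close>

lemma DERIV_ext_d_family:
  assumes fam: "smooth_form_family M 1 \<epsilon> \<omega>" and t: "t \<in> {-\<epsilon><..<\<epsilon>}"
    and c: "c \<in> atlas M" and x: "x \<in> cimg c"
  shows "((\<lambda>s. ext_d (\<omega> s) c x [p, q]) has_real_derivative ext_d (form_dot \<omega> t) c x [p, q]) (at t)"
proof -
  let ?I = "{-\<epsilon><..<\<epsilon>}"
  let ?F = "\<lambda>v z. \<omega> (fst z) c (snd z) [v]"
  have op: "open (?I \<times> cimg c)" using open_cimg[OF c] by (simp add: open_Times)
  have tx: "(t, x) \<in> ?I \<times> cimg c" using t x by simp
  have F: "smooth_on (?I \<times> cimg c) (?F v)" for v by (rule form_family_slice(4)[OF fam t c x])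
  have "((\<lambda>s. frechet_derivative (\<lambda>y. \<omega> s c y [q]) (at x) p) has_real_derivative
     frechet_derivative (\<lambda>y. form_dot \<omega> t c y [q]) (at x) p) (at t)" for p q
  proof -
    let ?Dp = "\<lambda>z. frechet_derivative (?F q) (at z) (0, p)"
    let ?D1 = "\<lambda>z. frechet_derivative (?F q) (at z) (1, 0)"
    have dp: "?Dp differentiable (at (t, x))" and d1: "?D1 differentiable (at (t, x))"
      by (intro smooth_on_differentiable[OF smooth_on_frechet_derivative[OF F] tx])+
    have "((\<lambda>s. ?Dp (s, x)) has_real_derivative frechet_derivative ?Dp (at (t, x)) (1, 0)) (at t)"
      by (rule DERIV_slice[OF dp])
    also have "frechet_derivative ?Dp (at (t, x)) (1, 0) = frechet_derivative ?D1 (at (t, x)) (0, p)"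
      by (rule frechet_derivative_commute[OF op tx F])
    also have "\<dots> = frechet_derivative (\<lambda>y. ?D1 (t, y)) (at x) p"
      by (simp add: frechet_derivative_eqI[OF frechet_derivative_slice(1)[OF d1]])
    also have "\<dots> = frechet_derivative (\<lambda>y. form_dot \<omega> t c y [q]) (at x) p"
      by (rule arg_cong[where f = "\<lambda>D. D p"], rule frechet_derivative_cong_open[OF open_cimg[OF c] x])
         (simp add: form_family_slice(1)[OF fam t c])
    finally show ?thesis
      by (rule has_field_derivative_transform_within_open[OF _ open_greaterThanLessThan t])
        (simp add: form_family_slice(3)[OF fam _ c x])
  qed
  then show ?thesis unfolding ext_d_1[OF x] by (intro DERIV_diff)
qed

text \<open>
  The derivative of the structure equation in the parameter, by which the family enters the proof.
\<close>

lemma ext_d_form_dot: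
  assumes \<alpha>: "smooth_form_family M 1 \<epsilon> \<alpha>" and \<beta>: "smooth_form_family M 1 \<epsilon> \<beta>"
    and t: "t \<in> {-\<epsilon><..<\<epsilon>}"
    and eq: "\<And>s. s \<in> {-\<epsilon><..<\<epsilon>} \<Longrightarrow> ext_d (\<alpha> s) = \<alpha> s \<and>\<^sub>f \<beta> s"
  shows "ext_d (form_dot \<alpha> t) = form_dot \<alpha> t \<and>\<^sub>f \<beta> t + \<alpha> t \<and>\<^sub>f form_dot \<beta> t"
proof (rule supported_eqI)
  have form: "is_form M 1 (\<alpha> s)" "is_form M 1 (\<beta> s)" if "s \<in> {-\<epsilon><..<\<epsilon>}" for s
    using \<alpha> \<beta> that by (simp_all add: smooth_form_family_def)
  note supp = form[THEN is_form_supported] is_form_form_dot[OF \<alpha> t, THEN is_form_supported]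
    is_form_form_dot[OF \<beta> t, THEN is_form_supported]
  show "supported M 2 (ext_d (form_dot \<alpha> t))"
    using supported_ext_d[OF supp(3)] by (simp add: numeral_2_eq_2)
  show "supported M 2 (form_dot \<alpha> t \<and>\<^sub>f \<beta> t + \<alpha> t \<and>\<^sub>f form_dot \<beta> t)"
    using supported_wedge[OF supp(3) supp(2)[OF t]] supported_wedge[OF supp(1)[OF t] supp(4)]
    by (intro supported_add) (simp_all add: numeral_2_eq_2)
  fix c x and vs :: "'e list" assume c: "c \<in> atlas M" and x: "x \<in> cimg c" and "length vs = 2"
  then obtain p q where vs: "vs = [p, q]" by (auto simp: length_Suc_conv numeral_2_eq_2)
  note D = form_family_slice(2)[OF \<alpha> t c x] form_family_slice(2)[OF \<beta> t c x]
  have "((\<lambda>s. \<alpha> s c x [p] * \<beta> s c x [q] - \<alpha> s c x [q] * \<beta> s c x [p]) has_real_derivative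
      ext_d (form_dot \<alpha> t) c x [p, q]) (at t)"
    by (rule has_field_derivative_transform_within_open
        [OF DERIV_ext_d_family[OF \<alpha> t c x] open_greaterThanLessThan t])
       (simp add: eq wedge_1_1[OF supp(1,2)] alt11_def)
  moreover have "((\<lambda>s. \<alpha> s c x [p] * \<beta> s c x [q] - \<alpha> s c x [q] * \<beta> s c x [p]) has_real_derivative
      (form_dot \<alpha> t c x [p] * \<beta> t c x [q] + form_dot \<beta> t c x [q] * \<alpha> t c x [p])
      - (form_dot \<alpha> t c x [q] * \<beta> t c x [p] + form_dot \<beta> t c x [p] * \<alpha> t c x [q])) (at t)"
    by (intro DERIV_diff DERIV_mult D)
  ultimately show "ext_d (form_dot \<alpha> t) c x vs = (form_dot \<alpha> t \<and>\<^sub>f \<beta> t + \<alpha> t \<and>\<^sub>f form_dot \<beta> t) c x vs"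
    using DERIV_unique
    by (fastforce simp: vs wedge_1_1[OF supp(3) supp(2)[OF t]] wedge_1_1[OF supp(1)[OF t] supp(4)]
        alt11_def)
qed

section \<open>Quotients of proportional one-forms\<close>

definition fun_form :: "(('a, 'e) chart \<Rightarrow> 'e \<Rightarrow> real) \<Rightarrow> ('a, 'e) form" where
  "fun_form h = (\<lambda>c x vs. if c \<in> atlas M \<and> x \<in> cimg c \<and> vs = [] then h c x else 0)"

lemma fun_form_apply [simp]: "c \<in> atlas M \<Longrightarrow> x \<in> cimg c \<Longrightarrow> fun_form h c x [] = h c x"
  by (simp add: fun_form_def)

lemma is_form_fun_form:
  assumes sm: "\<And>c. c \<in> atlas M \<Longrightarrow> smooth_on (cimg c) (h c)"
    and trans: "\<And>c c' y. c \<in> atlas M \<Longrightarrow> c' \<in> atlas M \<Longrightarrow> y \<in> overlap c c' \<Longrightarrow>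
        h c y = h c' (transition c c' y)"
  shows "is_form M 0 (fun_form h)"
proof (rule is_formI)
  show "supported M 0 (fun_form h)" by (simp add: supported_def fun_form_def)
  show "smooth_components M (fun_form h)"
    unfolding smooth_components_def
  proof (intro ballI allI)
    fix c and vs :: "'e list" assume c: "c \<in> atlas M"
    have "smooth_on (cimg c) (\<lambda>x. if vs = [] then h c x else 0)"
      using sm[OF c] by (cases "vs = []") simp_all
    then show "smooth_on (cimg c) (\<lambda>x. fun_form h c x vs)"
      by (rule smooth_on_cong[OF open_cimg[OF c], rotated]) (simp add: fun_form_def c)
  qed
  fix c c' y and vs :: "'e list"
  assume *: "c \<in> atlas M" "c' \<in> atlas M" "y \<in> overlap c c'" "length vs = 0"
  show "fun_form h c y vs = fun_form h c' (transition c c' y) (map (Dtransition c c' y) vs)"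
    using * trans[OF *(1-3)] subsetD[OF overlap_subset *(3)] transition_in_cimg[OF *(1,3)]
    unfolding fun_form_def by simp
qed auto

lemma ext_d_fun_form:
  assumes "c \<in> atlas M" "x \<in> cimg c"
  shows "ext_d (fun_form h) c x [p] = frechet_derivative (h c) (at x) p"
  unfolding ext_d_0[OF assms(2)]
  by (rule arg_cong[where f = "\<lambda>D. D p"], rule frechet_derivative_cong_open[OF open_cimg assms(2)])
     (simp_all add: fun_form_def assms)

text \<open>
  The quotient is \<open>\<langle>\<theta>, \<alpha>\<rangle> / \<langle>\<alpha>, \<alpha>\<rangle>\<close> for the standard inner product of the chart. This formula is smooth
  at once on the whole chart image, and although the inner products depend on the chart, their
  quotient does not: where \<open>\<alpha>\<close> does not vanish, the factor of proportionality is unique.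
\<close>

lemma proportional_one_forms:
  assumes \<theta>: "is_form M 1 \<theta>" and \<alpha>: "is_form M 1 \<alpha>"
    and nz: "\<And>c x. c \<in> atlas M \<Longrightarrow> x \<in> cimg c \<Longrightarrow> \<exists>v. \<alpha> c x [v] \<noteq> 0"
    and ratio: "\<And>c x p q. c \<in> atlas M \<Longrightarrow> x \<in> cimg c \<Longrightarrow>
       \<theta> c x [p] * \<alpha> c x [q] = \<theta> c x [q] * \<alpha> c x [p]"
  obtains g where "is_form M 0 g" "\<theta> = g \<and>\<^sub>f \<alpha>"
proof -
  let ?n = "\<lambda>c x. \<Sum>e\<in>Basis. \<alpha> c x [e] * \<alpha> c x [e]"
  define h where "h = (\<lambda>c x. (\<Sum>e\<in>Basis. \<theta> c x [e] * \<alpha> c x [e]) / ?n c x)"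
  have n: "?n c x \<noteq> 0" if *: "c \<in> atlas M" "x \<in> cimg c" for c x
  proof
    assume "?n c x = 0"
    then have "\<alpha> c x [e] = 0" if "e \<in> Basis" for e
      using that by (subst (asm) sum_nonneg_eq_0_iff) auto
    then have "\<alpha> c x [v] = 0" for v
      by (subst linear_eq_sum_Basis[OF is_form_1_linear[OF \<alpha> *]]) simp
    then show False using nz[OF *] by blast
  qed
  have h: "\<theta> c x [v] = h c x * \<alpha> c x [v]" if *: "c \<in> atlas M" "x \<in> cimg c" for c x v
  proof -
    have "\<theta> c x [v] * ?n c x = (\<Sum>e\<in>Basis. (\<theta> c x [v] * \<alpha> c x [e]) * \<alpha> c x [e])"
      by (simp add: sum_distrib_left mult.assoc)
    also have "\<dots> = (\<Sum>e\<in>Basis. \<theta> c x [e] * \<alpha> c x [e]) * \<alpha> c x [v]"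
      unfolding ratio[OF *, of v] sum_distrib_right by (simp add: ac_simps)
    finally show ?thesis using n[OF *] by (simp add: h_def field_simps)
  qed
  have form: "is_form M 0 (fun_form h)"
  proof (rule is_form_fun_form)
    fix c assume c: "c \<in> atlas M"
    note sm = smooth_componentsD[OF is_form_smooth_components[OF \<theta>] c]
      smooth_componentsD[OF is_form_smooth_components[OF \<alpha>] c]
    show "smooth_on (cimg c) (h c)"
      unfolding h_def
      by (intro smooth_on_divide smooth_on_sum smooth_on_mult open_cimg[OF c] sm n[OF c])
  next
    fix c c' y assume *: "c \<in> atlas M" "c' \<in> atlas M" "y \<in> overlap c c'"
    have y: "y \<in> cimg c" "transition c c' y \<in> cimg c'"
      using subsetD[OF overlap_subset *(3)] transition_in_cimg[OF *(1,3)] by blast+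
    obtain v where v: "\<alpha> c y [v] \<noteq> 0" using nz[OF *(1) y(1)] by blast
    have "h c y * \<alpha> c y [v] = h c' (transition c c' y) * \<alpha> c y [v]"
      using h[OF *(1) y(1), of v] h[OF *(2) y(2), of "Dtransition c c' y v"]
        is_form_transition[OF \<theta> *, of "[v]"] is_form_transition[OF \<alpha> *, of "[v]"] by simp
    then show "h c y = h c' (transition c c' y)" using v by simp
  qed
  moreover have "\<theta> = fun_form h \<and>\<^sub>f \<alpha>"
  proof (rule supported_eqI[OF is_form_supported[OF \<theta>]])
    note s = is_form_supported[OF form] is_form_supported[OF \<alpha>]
    show "supported M 1 (fun_form h \<and>\<^sub>f \<alpha>)" using supported_wedge[OF s] by simp
    fix c x and vs :: "'e list" assume *: "c \<in> atlas M" "x \<in> cimg c" "length vs = 1"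
    then obtain v where "vs = [v]" by (auto simp: length_Suc_conv)
    then show "\<theta> c x vs = (fun_form h \<and>\<^sub>f \<alpha>) c x vs"
      using h[OF *(1,2)] * by (simp add: wedge_0_1[OF s])
  qed
  ultimately show thesis using that by blast
qed


section \<open>Changing the defining form\<close>

lemma supported_wedge_1_1:
  "supported M 1 a \<Longrightarrow> supported M 1 b \<Longrightarrow> supported M 2 (a \<and>\<^sub>f b)"
  using supported_wedge[of M 1 a 1 b] by (simp add: numeral_2_eq_2)

lemma supported_ext_d_1: "supported M 1 a \<Longrightarrow> supported M 2 (ext_d a)"
  using supported_ext_d[of M 1 a] by (simp add: numeral_2_eq_2)

lemma two_form_eqI:
  assumes "supported M 2 \<omega>" "supported M 2 \<eta>"
    "\<And>c x p q. c \<in> atlas M \<Longrightarrow> x \<in> cimg c \<Longrightarrow> \<omega> c x [p, q] = \<eta> c x [p, q]"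
  shows "\<omega> = \<eta>"
proof (rule supported_eqI[OF assms(1,2)])
  fix c x and vs :: "'e list" assume *: "c \<in> atlas M" "x \<in> cimg c" "length vs = 2"
  then obtain p q where "vs = [p, q]" by (auto simp: length_Suc_conv numeral_2_eq_2)
  then show "\<omega> c x vs = \<eta> c x vs" using assms(3) * by simp
qed

lemma four_form_eqI:
  assumes "supported M 4 \<omega>" "supported M 4 \<eta>"
    "\<And>c x p q r s. c \<in> atlas M \<Longrightarrow> x \<in> cimg c \<Longrightarrow> \<omega> c x [p, q, r, s] = \<eta> c x [p, q, r, s]"
  shows "\<omega> = \<eta>"
proof (rule supported_eqI[OF assms(1,2)])
  fix c x and vs :: "'e list" assume *: "c \<in> atlas M" "x \<in> cimg c" "length vs = 4"
  then obtain p q r s where "vs = [p, q, r, s]" by (auto simp: length_Suc_conv eval_nat_numeral)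
  then show "\<omega> c x vs = \<eta> c x vs" using assms(3) * by simp
qed

text \<open>
  The function is \<open>l = - log k\<close>, with the sign for which \<open>k \<alpha>0\<close> has the structure form
  \<open>B + dl\<close> when \<open>\<alpha>0\<close> has the structure form \<open>B\<close>.
\<close>

lemma log_derivative:
  assumes k: "is_form M 0 k" and pos: "\<And>c x. c \<in> atlas M \<Longrightarrow> x \<in> cimg c \<Longrightarrow> k c x [] > 0"
  obtains l where "is_form M 0 l"
    "\<And>c x v. c \<in> atlas M \<Longrightarrow> x \<in> cimg c \<Longrightarrow> ext_d k c x [v] = - k c x [] * ext_d l c x [v]"
proof -
  define h where "h = (\<lambda>c x. - ln (k c x []))"
  have form: "is_form M 0 (fun_form h)"
  proof (rule is_form_fun_form)
    fix c assume c: "c \<in> atlas M"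
    show "smooth_on (cimg c) (h c)"
      unfolding h_def
      using smooth_componentsD[OF is_form_smooth_components[OF k] c] pos[OF c]
      by (intro smooth_on_minus smooth_on_ln open_cimg[OF c])
  next
    fix c c' y assume "c \<in> atlas M" "c' \<in> atlas M" "y \<in> overlap c c'"
    from is_form_transition[OF k this, of "[]"] show "h c y = h c' (transition c c' y)"
      by (simp add: h_def)
  qed
  have "ext_d k c x [v] = - k c x [] * ext_d (fun_form h) c x [v]"
    if c: "c \<in> atlas M" and x: "x \<in> cimg c" for c x v
  proof -
    have "((\<lambda>y. k c y []) has_derivative frechet_derivative (\<lambda>y. k c y []) (at x)) (at x)"
      by (intro differentiable_has_frechet_derivative smooth_components_differentiable
          is_form_smooth_components[OF k] c x)
    from has_derivative_minus[OF has_derivative_ln[OF pos[OF c x] this]]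
    have "frechet_derivative (h c) (at x) =
        (\<lambda>v. - (frechet_derivative (\<lambda>y. k c y []) (at x) v / k c x []))"
      unfolding h_def by (intro frechet_derivative_eqI) (simp add: divide_inverse)
    then show ?thesis
      using pos[OF c x] by (simp add: ext_d_fun_form[OF c x] ext_d_0[OF x, of k])
  qed
  with form that show thesis by blast
qed

lemma half_square:
  assumes g: "is_form M 0 g"
  obtains h where "is_form M 0 h"
    "\<And>c x v. c \<in> atlas M \<Longrightarrow> x \<in> cimg c \<Longrightarrow> ext_d h c x [v] = g c x [] * ext_d g c x [v]"
proof -
  define h where "h = (\<lambda>c x. 1 / 2 * (g c x [] * g c x []))"
  have form: "is_form M 0 (fun_form h)"
  proof (rule is_form_fun_form)
    fix c assume c: "c \<in> atlas M"
    show "smooth_on (cimg c) (h c)"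
      unfolding h_def
      using smooth_componentsD[OF is_form_smooth_components[OF g] c]
      by (intro smooth_on_mult open_cimg[OF c] smooth_on_const)
  next
    fix c c' y assume "c \<in> atlas M" "c' \<in> atlas M" "y \<in> overlap c c'"
    from is_form_transition[OF g this, of "[]"] show "h c y = h c' (transition c c' y)"
      by (simp add: h_def)
  qed
  have "ext_d (fun_form h) c x [v] = g c x [] * ext_d g c x [v]"
    if c: "c \<in> atlas M" and x: "x \<in> cimg c" for c x v
  proof -
    have d: "(\<lambda>y. g c y []) differentiable (at x)"
      by (intro smooth_components_differentiable is_form_smooth_components[OF g] c x)
    have "frechet_derivative (h c) (at x) v =
        1 / 2 * frechet_derivative (\<lambda>y. g c y [] * g c y []) (at x) v"
      unfolding h_def using d by (subst frechet_derivative_mult) (auto intro: differentiable_mult)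
    then show ?thesis
      using d by (simp add: ext_d_fun_form[OF c x] ext_d_0[OF x, of g] frechet_derivative_mult)
  qed
  with form that show thesis by blast
qed

text \<open>
  The form that represents the class changes by an exact form when the defining form is rescaled and
  another structure form is chosen. The forms \<open>A\<close> and \<open>b'\<close> are what the derivatives \<open>a\<close> and \<open>b\<close>
  become: they satisfy the differentiated structure equation for \<open>\<alpha>\<close> and \<open>\<beta>\<close>.
\<close>

lemma tgv_form_gauge_change:
  assumes forms: "is_form M 1 \<alpha>0" "is_form M 1 B" "is_form M 1 a" "is_form M 1 b"
      "is_form M 1 \<beta>" "is_form M 1 \<gamma>" "is_form M 0 k"
    and d\<alpha>0: "ext_d \<alpha>0 = \<alpha>0 \<and>\<^sub>f B" and da: "ext_d a = a \<and>\<^sub>f B + \<alpha>0 \<and>\<^sub>f b"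
    and \<alpha>: "\<alpha> = k \<and>\<^sub>f \<alpha>0" and k: "\<And>c x. c \<in> atlas M \<Longrightarrow> x \<in> cimg c \<Longrightarrow> k c x [] > 0"
    and nz: "\<And>c x. c \<in> atlas M \<Longrightarrow> x \<in> cimg c \<Longrightarrow> \<exists>v. \<alpha> c x [v] \<noteq> 0"
    and d\<alpha>: "ext_d \<alpha> = \<alpha> \<and>\<^sub>f \<beta>" and d\<beta>: "ext_d \<beta> = \<alpha> \<and>\<^sub>f \<gamma>"
  obtains A b' \<eta> where "is_form M 1 A" "is_form M 1 b'" "is_form M 3 \<eta>"
    "ext_d A = A \<and>\<^sub>f \<beta> + \<alpha> \<and>\<^sub>f b'"
    "b \<and>\<^sub>f B \<and>\<^sub>f ext_d B = b' \<and>\<^sub>f \<beta> \<and>\<^sub>f ext_d \<beta> + ext_d \<eta>"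
proof -
  obtain l where l: "is_form M 0 l"
    and dk: "\<And>c x v. c \<in> atlas M \<Longrightarrow> x \<in> cimg c \<Longrightarrow> ext_d k c x [v] = - k c x [] * ext_d l c x [v]"
    using log_derivative[OF forms(7) k] by blast
  have u: "is_form M 1 (ext_d l)" by (rule is_form_ext_d_0[OF l])
  have \<alpha>_form: "is_form M 1 \<alpha>" unfolding \<alpha> by (rule is_form_wedge_0_1[OF forms(7,1)])
  note S = forms(1-6)[THEN is_form_supported] \<alpha>_form[THEN is_form_supported] u[THEN is_form_supported]
  note K = forms(7)[THEN is_form_supported]
  note C = forms(1-6)[THEN is_form_smooth_components] \<alpha>_form[THEN is_form_smooth_components]
    u[THEN is_form_smooth_components]
  note CK = forms(7)[THEN is_form_smooth_components]
  have \<alpha>_at: "\<alpha> c x [v] = k c x [] * \<alpha>0 c x [v]" for c x v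
    unfolding \<alpha> by (rule wedge_0_1[OF K S(1)])

  \<comment> \<open>Both \<open>B + dl\<close> and \<open>\<beta>\<close> solve the structure equation of \<open>\<alpha>\<close>, so
    they differ by a multiple of \<open>\<alpha>\<close>.\<close>
  let ?\<theta> = "B + ext_d l - \<beta>"
  have \<theta>: "is_form M 1 ?\<theta>" by (intro is_form_diff is_form_add forms u)
  have \<theta>_\<alpha>: "?\<theta> c x [p] * \<alpha> c x [q] = ?\<theta> c x [q] * \<alpha> c x [p]"
    if c: "c \<in> atlas M" and x: "x \<in> cimg c" for c x p q
  proof -
    have "alt11 (\<lambda>v. \<alpha> c x [v]) (\<lambda>v. \<beta> c x [v]) p q = ext_d \<alpha> c x [p, q]"
      by (simp only: wedge_1_1[OF S(7,5)] d\<alpha>)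
    also have "\<dots> = alt11 (\<lambda>v. ext_d k c x [v]) (\<lambda>v. \<alpha>0 c x [v]) p q
        + k c x [] * alt11 (\<lambda>v. \<alpha>0 c x [v]) (\<lambda>v. B c x [v]) p q"
      unfolding \<alpha> ext_d_wedge_0_1[OF K S(1) CK C(1) c x] d\<alpha>0 wedge_1_1[OF S(1,2)] ..
    finally show ?thesis
      by (simp add: alt11_def dk[OF c x] \<alpha>_at algebra_simps)
  qed
  obtain g where g: "is_form M 0 g" and \<theta>_eq: "?\<theta> = g \<and>\<^sub>f \<alpha>"
    using proportional_one_forms[OF \<theta> \<alpha>_form nz \<theta>_\<alpha>] by blast
  note G = is_form_supported[OF g] is_form_smooth_components[OF g]
  have B_at: "B c x [v] = \<beta> c x [v] + g c x [] * \<alpha> c x [v] - ext_d l c x [v]" for c x v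
    using arg_cong[OF \<theta>_eq, of "\<lambda>\<omega>. \<omega> c x [v]"] by (simp add: wedge_0_1[OF G(1) S(7)])

  define A where "A = k \<and>\<^sub>f a"
  define b' where "b' = b - g \<and>\<^sub>f A"
  have A: "is_form M 1 A" unfolding A_def by (rule is_form_wedge_0_1[OF forms(7,3)])
  have b': "is_form M 1 b'" unfolding b'_def by (intro is_form_diff forms is_form_wedge_0_1 g A)
  note SA = is_form_supported[OF A] is_form_supported[OF b']
  note CA = is_form_smooth_components[OF A]
  have A_at: "A c x [v] = k c x [] * a c x [v]" for c x v
    unfolding A_def by (rule wedge_0_1[OF K S(3)])
  have b_at: "b c x [v] = b' c x [v] + g c x [] * A c x [v]" for c x v
    by (simp add: b'_def wedge_0_1[OF G(1) SA(1)])

  have dA_at: "ext_d A c x [p, q] = alt11 (\<lambda>v. A c x [v]) (\<lambda>v. \<beta> c x [v]) p q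
      + alt11 (\<lambda>v. \<alpha> c x [v]) (\<lambda>v. b' c x [v]) p q"
    if c: "c \<in> atlas M" and x: "x \<in> cimg c" for c x p q
  proof -
    have "ext_d A c x [p, q] = alt11 (\<lambda>v. ext_d k c x [v]) (\<lambda>v. a c x [v]) p q
      + k c x [] * (alt11 (\<lambda>v. a c x [v]) (\<lambda>v. B c x [v]) p q
        + alt11 (\<lambda>v. \<alpha>0 c x [v]) (\<lambda>v. b c x [v]) p q)"
      unfolding A_def ext_d_wedge_0_1[OF K S(3) CK C(3) c x] da plus_fun_apply
        wedge_1_1[OF S(3,2)] wedge_1_1[OF S(1,4)] ..
    then show ?thesis
      by (simp add: alt11_def dk[OF c x] B_at b_at \<alpha>_at A_at algebra_simps)
  qed
  have dA: "ext_d A = A \<and>\<^sub>f \<beta> + \<alpha> \<and>\<^sub>f b'"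
    using dA_at wedge_1_1[OF SA(1) S(5)] wedge_1_1[OF S(7) SA(2)]
    by (intro two_form_eqI supported_add supported_wedge_1_1 supported_ext_d_1 S SA) simp_all

  \<comment> \<open>The closed form \<open>dl\<close> does not contribute to \<open>dB = d (\<beta> + g \<alpha> - dl)\<close>.\<close>
  have dB_at: "ext_d B c x [p, q] = alt11 (\<lambda>v. \<alpha> c x [v]) (\<lambda>v. \<gamma> c x [v]) p q
      + alt11 (\<lambda>v. ext_d g c x [v]) (\<lambda>v. \<alpha> c x [v]) p q
      + g c x [] * alt11 (\<lambda>v. \<alpha> c x [v]) (\<lambda>v. \<beta> c x [v]) p q"
    if c: "c \<in> atlas M" and x: "x \<in> cimg c" for c x p q
  proof -
    have sum: "smooth_components M (B + ext_d l)"
      by (rule is_form_smooth_components[OF is_form_add[OF forms(2) u]])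
    have "ext_d B c x [p, q] - ext_d \<beta> c x [p, q] = ext_d ?\<theta> c x [p, q]"
      unfolding ext_d_diff[OF sum C(5) c x] ext_d_add[OF C(2) C(8) c x]
        ext_d_ext_d_0[OF is_form_smooth_components[OF l] c x] by simp
    also have "\<dots> = alt11 (\<lambda>v. ext_d g c x [v]) (\<lambda>v. \<alpha> c x [v]) p q
      + g c x [] * alt11 (\<lambda>v. \<alpha> c x [v]) (\<lambda>v. \<beta> c x [v]) p q"
      unfolding \<theta>_eq ext_d_wedge_0_1[OF G(1) S(7) G(2) C(7) c x] d\<alpha> wedge_1_1[OF S(7,5)] ..
    finally show ?thesis by (simp add: d\<beta> wedge_1_1[OF S(7,6)])
  qed
  have dB_alt11: "(\<lambda>p q. ext_d B c x [p, q]) = alt11 (\<lambda>v. \<alpha> c x [v])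
      (\<lambda>v. \<gamma> c x [v] - ext_d g c x [v] + g c x [] * \<beta> c x [v])"
    if "c \<in> atlas M" "x \<in> cimg c" for c x
    by (intro ext) (simp add: dB_at[OF that] alt11_def algebra_simps)

  \<comment> \<open>Since \<open>dB\<close> is divisible by \<open>\<alpha>\<close>, it is enough that \<open>\<alpha> \<and> db = - A \<and> dB\<close>. Up to the factor
    \<open>k\<close> this is \<open>d (da) = 0\<close>, in which the terms that contain \<open>\<alpha>0 \<and> b \<and> B\<close> cancel.\<close>
  have db_dB: "alt22 (\<lambda>p q. ext_d b c x [p, q]) (\<lambda>p q. ext_d B c x [p, q]) p q r s = 0"
    if c: "c \<in> atlas M" and x: "x \<in> cimg c" for c x p q r s
    unfolding dB_alt11[OF c x]
  proof (rule alt22_eq_0)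
    fix p q r
    have "0 = ext_d (a \<and>\<^sub>f B + \<alpha>0 \<and>\<^sub>f b) c x [p, q, r]"
      using ext_d_ext_d_1[OF C(3) c x] da by simp
    also have "\<dots> = alt12 (\<lambda>v. B c x [v]) (\<lambda>v w. ext_d a c x [v, w]) p q r
        - alt12 (\<lambda>v. a c x [v]) (\<lambda>v w. ext_d B c x [v, w]) p q r
        + (alt12 (\<lambda>v. b c x [v]) (\<lambda>v w. ext_d \<alpha>0 c x [v, w]) p q r
        - alt12 (\<lambda>v. \<alpha>0 c x [v]) (\<lambda>v w. ext_d b c x [v, w]) p q r)"
      unfolding ext_d_add[OF smooth_components_wedge[OF C(3,2)] smooth_components_wedge[OF C(1,4)] c x]
        ext_d_wedge_1_1[OF S(3,2) C(3,2) c x] ext_d_wedge_1_1[OF S(1,4) C(1,4) c x] ..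
    also have "\<dots> = - alt12 (\<lambda>v. a c x [v]) (\<lambda>v w. ext_d B c x [v, w]) p q r
        - alt12 (\<lambda>v. \<alpha>0 c x [v]) (\<lambda>v w. ext_d b c x [v, w]) p q r"
      by (simp add: da d\<alpha>0 wedge_1_1[OF S(3,2)] wedge_1_1[OF S(1,4)] wedge_1_1[OF S(1,2)]
          alt11_def alt12_def algebra_simps)
    finally have "alt12 (\<lambda>v. \<alpha>0 c x [v]) (\<lambda>v w. ext_d b c x [v, w]) p q r =
        - alt12 (\<lambda>v. a c x [v]) (\<lambda>v w. ext_d B c x [v, w]) p q r" by simp
    moreover have "alt12 (\<lambda>v. \<alpha> c x [v]) w p q r = k c x [] * alt12 (\<lambda>v. \<alpha>0 c x [v]) w p q r"
      "alt12 (\<lambda>v. A c x [v]) w p q r = k c x [] * alt12 (\<lambda>v. a c x [v]) w p q r" for w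
      by (simp_all add: alt12_def \<alpha>_at A_at algebra_simps)
    ultimately show "alt12 (\<lambda>v. \<alpha> c x [v]) (\<lambda>p q. ext_d b c x [p, q]) p q r =
      - alt12 (\<lambda>v. A c x [v]) (alt11 (\<lambda>v. \<alpha> c x [v])
          (\<lambda>v. \<gamma> c x [v] - ext_d g c x [v] + g c x [] * \<beta> c x [v])) p q r"
      unfolding dB_alt11[OF c x, symmetric] by simp
  qed

  \<comment> \<open>The function \<open>h\<close> is \<open>g\<^sup>2 / 2\<close>: its derivative \<open>g dg\<close> accounts for the term of
    \<open>b \<and> B \<and> dB\<close> that is quadratic in \<open>g\<close>.\<close>
  obtain h where h: "is_form M 0 h"
    and dh: "\<And>c x v. c \<in> atlas M \<Longrightarrow> x \<in> cimg c \<Longrightarrow> ext_d h c x [v] = g c x [] * ext_d g c x [v]"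
    using half_square[OF g] by blast
  let ?lb = "l \<and>\<^sub>f b" and ?g\<beta> = "g \<and>\<^sub>f \<beta>" and ?hA = "h \<and>\<^sub>f A"
  define \<eta> where "\<eta> = ?lb \<and>\<^sub>f ext_d B + ?g\<beta> \<and>\<^sub>f ext_d A - ?hA \<and>\<^sub>f ext_d \<alpha>"
  have lb: "is_form M 1 ?lb" and g\<beta>: "is_form M 1 ?g\<beta>" and hA: "is_form M 1 ?hA"
    by (intro is_form_wedge_0_1 l g h A forms)+
  have parts: "is_form M 3 (?lb \<and>\<^sub>f ext_d B)" "is_form M 3 (?g\<beta> \<and>\<^sub>f ext_d A)"
      "is_form M 3 (?hA \<and>\<^sub>f ext_d \<alpha>)"
    by (intro is_form_wedge_1_2 is_form_ext_d_1 lb g\<beta> hA forms A \<alpha>_form)+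
  then have \<eta>: "is_form M 3 \<eta>" unfolding \<eta>_def by (intro is_form_add is_form_diff)
  note L = l[THEN is_form_supported] l[THEN is_form_smooth_components]
  note H = h[THEN is_form_supported] h[THEN is_form_smooth_components]

  have d\<eta>_at: "ext_d \<eta> c x [p, q, r, s] =
      alt22 (\<lambda>v w. alt11 (\<lambda>v. ext_d l c x [v]) (\<lambda>v. b c x [v]) v w + l c x [] * ext_d b c x [v, w])
        (\<lambda>v w. ext_d B c x [v, w]) p q r s
      + alt22 (\<lambda>v w. alt11 (\<lambda>v. ext_d g c x [v]) (\<lambda>v. \<beta> c x [v]) v w
          + g c x [] * alt11 (\<lambda>v. \<alpha> c x [v]) (\<lambda>v. \<gamma> c x [v]) v w)
        (\<lambda>v w. ext_d A c x [v, w]) p q r s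
      - alt22 (\<lambda>v w. g c x [] * alt11 (\<lambda>v. ext_d g c x [v]) (\<lambda>v. A c x [v]) v w
          + h c x [] * ext_d A c x [v, w])
        (alt11 (\<lambda>v. \<alpha> c x [v]) (\<lambda>v. \<beta> c x [v])) p q r s"
    if c: "c \<in> atlas M" and x: "x \<in> cimg c" for c x p q r s
  proof -
    note P = parts[THEN is_form_smooth_components]
    have P12: "smooth_components M (?lb \<and>\<^sub>f ext_d B + ?g\<beta> \<and>\<^sub>f ext_d A)"
      by (rule is_form_smooth_components[OF is_form_add[OF parts(1,2)]])
    have "ext_d \<eta> c x [p, q, r, s] =
        alt22 (\<lambda>v w. ext_d ?lb c x [v, w]) (\<lambda>v w. ext_d B c x [v, w]) p q r s
        + alt22 (\<lambda>v w. ext_d ?g\<beta> c x [v, w]) (\<lambda>v w. ext_d A c x [v, w]) p q r s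
        - alt22 (\<lambda>v w. ext_d ?hA c x [v, w]) (\<lambda>v w. ext_d \<alpha> c x [v, w]) p q r s"
      unfolding \<eta>_def ext_d_diff[OF P12 P(3) c x] ext_d_add[OF P(1,2) c x]
      by (simp only: ext_d_wedge_1_ext_d is_form_supported[OF lb] is_form_smooth_components[OF lb]
          is_form_supported[OF g\<beta>] is_form_smooth_components[OF g\<beta>]
          is_form_supported[OF hA] is_form_smooth_components[OF hA] S C SA CA c x)
    moreover have "alt11 (\<lambda>v. ext_d h c x [v]) (\<lambda>v. A c x [v]) v w =
        g c x [] * alt11 (\<lambda>v. ext_d g c x [v]) (\<lambda>v. A c x [v]) v w" for v w
      by (simp add: dh[OF c x] alt11_def algebra_simps)
    ultimately show ?thesis
      unfolding ext_d_wedge_0_1[OF L(1) S(4) L(2) C(4) c x] ext_d_wedge_0_1[OF G(1) S(5) G(2) C(5) c x]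
        ext_d_wedge_0_1[OF H(1) SA(1) H(2) CA c x] d\<alpha> d\<beta> wedge_1_1[OF S(7,5)] wedge_1_1[OF S(7,6)]
      by simp
  qed

  have "b \<and>\<^sub>f B \<and>\<^sub>f ext_d B = b' \<and>\<^sub>f \<beta> \<and>\<^sub>f ext_d \<beta> + ext_d \<eta>"
  proof (rule four_form_eqI)
    note two = supported_wedge_1_1[OF S(4,2)] supported_ext_d_1[OF S(2)]
      supported_wedge_1_1[OF SA(2) S(5)] supported_ext_d_1[OF S(5)]
    show "supported M 4 (b \<and>\<^sub>f B \<and>\<^sub>f ext_d B)"
      using supported_wedge[OF two(1,2)] by simp
    show "supported M 4 (b' \<and>\<^sub>f \<beta> \<and>\<^sub>f ext_d \<beta> + ext_d \<eta>)"
      using supported_wedge[OF two(3,4)] supported_ext_d[OF is_form_supported[OF \<eta>]]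
      by (intro supported_add) (simp_all add: eval_nat_numeral)
    fix c x p q r s assume c: "c \<in> atlas M" and x: "x \<in> cimg c"
    let ?dB = "\<lambda>v w. ext_d B c x [v, w]" and ?dA = "\<lambda>v w. ext_d A c x [v, w]"
    let ?b = "\<lambda>v. b c x [v]" and ?u = "\<lambda>v. ext_d l c x [v]" and ?\<beta> = "\<lambda>v. \<beta> c x [v]"
    let ?\<alpha> = "\<lambda>v. \<alpha> c x [v]"
    have "(b \<and>\<^sub>f B \<and>\<^sub>f ext_d B) c x [p, q, r, s] = alt22 (alt11 ?b (\<lambda>v. B c x [v])) ?dB p q r s"
      unfolding wedge_2_2[OF two(1,2)] wedge_1_1[OF S(4,2)] ..
    also have "\<dots> = alt22 (alt11 ?b (\<lambda>v. ?\<beta> v + g c x [] * ?\<alpha> v)) ?dB p q r s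
        + alt22 (alt11 ?u ?b) ?dB p q r s"
      by (simp add: B_at alt22_def alt11_def algebra_simps)
    also have "alt22 (alt11 ?u ?b) ?dB p q r s =
        alt22 (\<lambda>v w. alt11 ?u ?b v w + l c x [] * ext_d b c x [v, w]) ?dB p q r s"
    proof -
      have "alt22 (\<lambda>v w. alt11 ?u ?b v w + l c x [] * ext_d b c x [v, w]) ?dB p q r s =
        alt22 (alt11 ?u ?b) ?dB p q r s
        + l c x [] * alt22 (\<lambda>v w. ext_d b c x [v, w]) ?dB p q r s"
        by (simp add: alt22_def algebra_simps)
      then show ?thesis unfolding db_dB[OF c x] by simp
    qed
    also have "alt22 (alt11 ?b (\<lambda>v. ?\<beta> v + g c x [] * ?\<alpha> v)) ?dB p q r s =
        alt22 (alt11 (\<lambda>v. b' c x [v]) ?\<beta>) (alt11 ?\<alpha> (\<lambda>v. \<gamma> c x [v])) p q r s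
        + alt22 (\<lambda>v w. alt11 (\<lambda>v. ext_d g c x [v]) ?\<beta> v w
            + g c x [] * alt11 ?\<alpha> (\<lambda>v. \<gamma> c x [v]) v w) ?dA p q r s
        - alt22 (\<lambda>v w. g c x [] * alt11 (\<lambda>v. ext_d g c x [v]) (\<lambda>v. A c x [v]) v w
            + h c x [] * ?dA v w) (alt11 ?\<alpha> ?\<beta>) p q r s"
      unfolding b_at dB_at[OF c x] by (rule alt22_gauge_change) (simp add: dA_at[OF c x])
    finally show "(b \<and>\<^sub>f B \<and>\<^sub>f ext_d B) c x [p, q, r, s] =
        (b' \<and>\<^sub>f \<beta> \<and>\<^sub>f ext_d \<beta> + ext_d \<eta>) c x [p, q, r, s]"
      unfolding plus_fun_apply d\<eta>_at[OF c x] wedge_2_2[OF two(3,4)] wedge_1_1[OF SA(2) S(5)]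
      unfolding d\<beta> wedge_1_1[OF S(7,6)] by simp
  qed
  then show thesis using that A b' \<eta> dA by blast
qed

section \<open>Vanishing of the class\<close>

text \<open>
  By \<open>d (d\<beta>) = 0\<close> and \<open>d\<gamma> = 0\<close> the three-form \<open>\<alpha> \<and> \<beta> \<and> \<gamma>\<close> vanishes, and up to sign it is
  \<open>\<beta> \<and> d\<beta>\<close>.
\<close>

lemma tgv_form_zero_if_closed_gamma:
  assumes forms: "is_form M 1 \<alpha>" "is_form M 1 \<beta>" "is_form M 1 \<gamma>" "is_form M 1 b"
    and d\<alpha>: "ext_d \<alpha> = \<alpha> \<and>\<^sub>f \<beta>" and d\<beta>: "ext_d \<beta> = \<alpha> \<and>\<^sub>f \<gamma>" and d\<gamma>: "ext_d \<gamma> = 0"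
  shows "b \<and>\<^sub>f \<beta> \<and>\<^sub>f ext_d \<beta> = 0"
proof (rule four_form_eqI)
  note S = forms[THEN is_form_supported] and C = forms[THEN is_form_smooth_components]
  note two = supported_wedge_1_1[OF S(4,2)] supported_ext_d_1[OF S(2)]
  show "supported M 4 (b \<and>\<^sub>f \<beta> \<and>\<^sub>f ext_d \<beta>)" using supported_wedge[OF two] by simp
  fix c x p q r s assume c: "c \<in> atlas M" and x: "x \<in> cimg c"
  have "alt12 (\<lambda>v. \<alpha> c x [v]) (alt11 (\<lambda>v. \<beta> c x [v]) (\<lambda>v. \<gamma> c x [v])) p q r = 0" for p q r
  proof -
    have "0 = ext_d (\<alpha> \<and>\<^sub>f \<gamma>) c x [p, q, r]"
      using ext_d_ext_d_1[OF C(2) c x] d\<beta> by simp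
    also have "\<dots> = alt12 (\<lambda>v. \<gamma> c x [v]) (alt11 (\<lambda>v. \<alpha> c x [v]) (\<lambda>v. \<beta> c x [v])) p q r"
      unfolding ext_d_wedge_1_1[OF S(1,3) C(1,3) c x] d\<alpha> d\<gamma> wedge_1_1[OF S(1,2)]
      by (simp add: alt12_def)
    finally show ?thesis by (simp add: alt12_def alt11_def algebra_simps)
  qed
  then show "(b \<and>\<^sub>f \<beta> \<and>\<^sub>f ext_d \<beta>) c x [p, q, r, s] = (0 :: ('a, 'e) form) c x [p, q, r, s]"
    unfolding wedge_2_2[OF two] wedge_1_1[OF S(4,2)] zero_fun_apply
    unfolding d\<beta> wedge_1_1[OF S(1,3)] by (rule alt22_vanishes)
qed simp

text \<open>
  By \<open>d (d\<gamma>) = 0\<close> and \<open>d\<delta> = 0\<close> the three-form \<open>\<alpha> \<and> \<beta> \<and> \<delta>\<close>, which occurs there with the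
  coefficient two, vanishes. Then \<open>dA \<and> d\<gamma>\<close> collapses to \<open>\<alpha> \<and> b \<and> \<beta> \<and> \<gamma>\<close>.
\<close>

lemma tgv_form_exact_if_closed_delta:
  assumes forms: "is_form M 1 \<alpha>" "is_form M 1 \<beta>" "is_form M 1 \<gamma>" "is_form M 1 \<delta>"
      "is_form M 1 A" "is_form M 1 b"
    and d\<alpha>: "ext_d \<alpha> = \<alpha> \<and>\<^sub>f \<beta>" and d\<beta>: "ext_d \<beta> = \<alpha> \<and>\<^sub>f \<gamma>"
    and d\<gamma>: "ext_d \<gamma> = \<beta> \<and>\<^sub>f \<gamma> + \<alpha> \<and>\<^sub>f \<delta>" and d\<delta>: "ext_d \<delta> = 0"
    and dA: "ext_d A = A \<and>\<^sub>f \<beta> + \<alpha> \<and>\<^sub>f b"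
  shows "b \<and>\<^sub>f \<beta> \<and>\<^sub>f ext_d \<beta> = ext_d (A \<and>\<^sub>f ext_d \<gamma>)"
proof (rule four_form_eqI)
  note S = forms[THEN is_form_supported] and C = forms[THEN is_form_smooth_components]
  note two = supported_wedge_1_1[OF S(6,2)] supported_ext_d_1[OF S(2)]
  show "supported M 4 (b \<and>\<^sub>f \<beta> \<and>\<^sub>f ext_d \<beta>)" using supported_wedge[OF two] by simp
  show "supported M 4 (ext_d (A \<and>\<^sub>f ext_d \<gamma>))"
    using supported_ext_d[OF supported_wedge[OF S(5) supported_ext_d_1[OF S(3)]]]
    by (simp add: eval_nat_numeral)
  fix c x p q r s assume c: "c \<in> atlas M" and x: "x \<in> cimg c"
  have "alt12 (\<lambda>v. \<alpha> c x [v]) (alt11 (\<lambda>v. \<beta> c x [v]) (\<lambda>v. \<delta> c x [v])) p q r = 0" for p q r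
  proof -
    have "0 = ext_d (\<beta> \<and>\<^sub>f \<gamma> + \<alpha> \<and>\<^sub>f \<delta>) c x [p, q, r]"
      using ext_d_ext_d_1[OF C(3) c x] d\<gamma> by simp
    also have "\<dots> = alt12 (\<lambda>v. \<gamma> c x [v]) (\<lambda>v w. ext_d \<beta> c x [v, w]) p q r
        - alt12 (\<lambda>v. \<beta> c x [v]) (\<lambda>v w. ext_d \<gamma> c x [v, w]) p q r
        + alt12 (\<lambda>v. \<delta> c x [v]) (\<lambda>v w. ext_d \<alpha> c x [v, w]) p q r"
      unfolding ext_d_add[OF smooth_components_wedge[OF C(2,3)] smooth_components_wedge[OF C(1,4)] c x]
        ext_d_wedge_1_1[OF S(2,3) C(2,3) c x] ext_d_wedge_1_1[OF S(1,4) C(1,4) c x] d\<delta>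
      by (simp add: alt12_def)
    also have "\<dots> = 2 * alt12 (\<lambda>v. \<alpha> c x [v]) (alt11 (\<lambda>v. \<beta> c x [v]) (\<lambda>v. \<delta> c x [v])) p q r"
      by (simp add: d\<alpha> d\<beta> d\<gamma> wedge_1_1[OF S(1,2)] wedge_1_1[OF S(1,3)] wedge_1_1[OF S(2,3)]
          wedge_1_1[OF S(1,4)] alt12_def alt11_def algebra_simps)
    finally show ?thesis by simp
  qed
  from alt22_primitive[OF this]
  show "(b \<and>\<^sub>f \<beta> \<and>\<^sub>f ext_d \<beta>) c x [p, q, r, s] = ext_d (A \<and>\<^sub>f ext_d \<gamma>) c x [p, q, r, s]"
    unfolding ext_d_wedge_1_ext_d[OF S(5) C(5) S(3) C(3) c x] wedge_2_2[OF two] wedge_1_1[OF S(6,2)]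
    unfolding d\<beta> wedge_1_1[OF S(1,3)] dA d\<gamma> plus_fun_apply wedge_1_1[OF S(5,2)] wedge_1_1[OF S(1,6)]
      wedge_1_1[OF S(2,3)] wedge_1_1[OF S(1,4)] .
qed

text \<open>
  At each point both forms have the kernel of the differential of a distinguished function, which
  makes them proportional, and both are positive on vectors along which that function increases,
  which makes the factor positive.
\<close>

lemma defining_forms_proportional:
  assumes F: "foliation M F" and \<alpha>: "defining_form M F \<alpha>" and \<alpha>': "defining_form M F \<alpha>'"
  obtains k where "is_form M 0 k" "\<alpha> = k \<and>\<^sub>f \<alpha>'"
    "\<And>c x. c \<in> atlas M \<Longrightarrow> x \<in> cimg c \<Longrightarrow> k c x [] > 0"
proof -
  have forms: "is_form M 1 \<alpha>" "is_form M 1 \<alpha>'"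
    using \<alpha> \<alpha>' unfolding defining_form_def by blast+
  have nz: "\<exists>v. \<alpha>' c x [v] \<noteq> 0" if "c \<in> atlas M" "x \<in> cimg c" for c x
    using \<alpha>' that unfolding defining_form_def by blast
  have submersion: "\<exists>D :: 'e \<Rightarrow> real. linear D \<and> (\<exists>v. D v \<noteq> 0) \<and>
      (\<forall>v. \<alpha> c x [v] = 0 \<longleftrightarrow> D v = 0) \<and> (\<forall>v. \<alpha>' c x [v] = 0 \<longleftrightarrow> D v = 0) \<and>
      (\<forall>v. D v > 0 \<longrightarrow> \<alpha> c x [v] > 0 \<and> \<alpha>' c x [v] > 0)"
    if c: "c \<in> atlas M" and x: "x \<in> cimg c" for c x
  proof -
    define p where "p = cinv c x"
    have p: "p \<in> cdom c" "cmap c p = x" using cmap_cinv[OF x] by (simp_all add: p_def)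
    have "p \<in> topspace (mtop M)"
      using p c smooth_mfd unfolding smooth_manifold_def by blast
    then obtain U f where Uf: "(U, f) \<in> F" "p \<in> U" using F unfolding foliation_def by blast
    then have sub: "submersion_on M U f" using F unfolding foliation_def by blast
    have "smooth_on (cmap c ` (U \<inter> cdom c)) (f \<circ> cinv c)"
      and nz: "\<exists>v. fdiff f c p v \<noteq> 0"
      using sub c p Uf unfolding submersion_on_def by blast+
    then have "(f \<circ> cinv c) differentiable (at x)"
      using p Uf by (intro smooth_on_differentiable) auto
    then have lin: "linear (fdiff f c p)"
      unfolding fdiff_def p by (rule linear_frechet_derivative)
    have signs: "(\<alpha> c x [v] = 0 \<longleftrightarrow> fdiff f c p v = 0) \<and> (\<alpha>' c x [v] = 0 \<longleftrightarrow> fdiff f c p v = 0)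
        \<and> (fdiff f c p v > 0 \<longrightarrow> \<alpha> c x [v] > 0 \<and> \<alpha>' c x [v] > 0)" for v
      using \<alpha> \<alpha>' Uf c p unfolding defining_form_def by blast
    show ?thesis
      by (rule exI[of _ "fdiff f c p"]) (simp add: lin nz signs)
  qed
  have ratio: "\<alpha> c x [p] * \<alpha>' c x [q] = \<alpha> c x [q] * \<alpha>' c x [p]"
    if *: "c \<in> atlas M" "x \<in> cimg c" for c x p q
  proof -
    have lin: "linear (\<lambda>v. \<alpha> c x [v])" "linear (\<lambda>v. \<alpha>' c x [v])"
      by (rule is_form_1_linear[OF forms(1) *], rule is_form_1_linear[OF forms(2) *])
    \<comment> \<open>The combination of \<open>p\<close> and \<open>q\<close> in the common kernel.\<close>
    define w where "w = \<alpha> c x [q] *\<^sub>R p - \<alpha> c x [p] *\<^sub>R q"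
    have "\<alpha> c x [w] = 0"
      unfolding w_def linear_diff[OF lin(1)] linear_scale[OF lin(1)] by simp
    then have "\<alpha>' c x [w] = 0" using submersion[OF *] by blast
    then show ?thesis
      unfolding w_def linear_diff[OF lin(2)] linear_scale[OF lin(2)] by simp
  qed
  obtain k where k: "is_form M 0 k" "\<alpha> = k \<and>\<^sub>f \<alpha>'"
    using proportional_one_forms[OF forms nz ratio] by blast
  have "k c x [] > 0" if *: "c \<in> atlas M" "x \<in> cimg c" for c x
  proof -
    obtain D :: "'e \<Rightarrow> real" and v where D: "linear D" "D v \<noteq> 0"
      and pos: "\<And>v. D v > 0 \<Longrightarrow> \<alpha> c x [v] > 0 \<and> \<alpha>' c x [v] > 0"
      using submersion[OF *] by blast
    then have "D v > 0 \<or> D (- v) > 0" using linear_neg[OF D(1), of v] by auto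
    then obtain w where "D w > 0" by blast
    then have "\<alpha> c x [w] > 0" "\<alpha>' c x [w] > 0" using pos by blast+
    moreover have "\<alpha> c x [w] = k c x [] * \<alpha>' c x [w]"
      unfolding k(2) by (rule wedge_0_1[OF is_form_supported[OF k(1)] is_form_supported[OF forms(2)]])
    ultimately show ?thesis by (simp add: zero_less_mult_iff)
  qed
  with k that show thesis by blast
qed

lemma ext_d_zero: "ext_d 0 = (0 :: ('a, 'e) form)"
  by (intro ext) (simp add: ext_d_def)

lemma exact_form_4_iff: "exact_form M 4 \<mu> \<longleftrightarrow> (\<exists>\<xi>. is_form M 3 \<xi> \<and> \<mu> = ext_d \<xi>)"
proof -
  have "4 = Suc j \<longleftrightarrow> j = 3" for j by auto
  then show ?thesis
    using is_form_zero[of 3] ext_d_zero unfolding exact_form_def by metis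
qed

lemma exact_form_add_ext_d:
  assumes \<mu>: "exact_form M 4 \<mu>" and \<zeta>: "is_form M 3 \<zeta>"
  shows "exact_form M 4 (\<mu> + ext_d \<zeta>)"
proof -
  obtain \<xi> where \<xi>: "is_form M 3 \<xi>" "\<mu> = ext_d \<xi>"
    using \<mu> unfolding exact_form_4_iff by blast
  have "ext_d \<xi> + ext_d \<zeta> = ext_d (\<xi> + \<zeta>)"
  proof (rule four_form_eqI)
    show "supported M 4 (ext_d \<xi> + ext_d \<zeta>)" "supported M 4 (ext_d (\<xi> + \<zeta>))"
      using supported_ext_d[OF is_form_supported[OF \<xi>(1)]] supported_ext_d[OF is_form_supported[OF \<zeta>]]
        supported_ext_d[OF is_form_supported[OF is_form_add[OF \<xi>(1) \<zeta>]]]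
      by (auto simp: eval_nat_numeral intro: supported_add)
  qed (simp add: ext_d_add is_form_smooth_components[OF \<xi>(1)] is_form_smooth_components[OF \<zeta>])
  then have "\<mu> + ext_d \<zeta> = ext_d (\<xi> + \<zeta>)" using \<xi>(2) by simp
  moreover have "is_form M 3 (\<xi> + \<zeta>)" by (rule is_form_add[OF \<xi>(1) \<zeta>])
  ultimately show ?thesis unfolding exact_form_4_iff by blast
qed

lemma ext_d_uminus_3:
  assumes "is_form M 3 \<zeta>" shows "ext_d (- \<zeta>) = - ext_d \<zeta>"
proof (rule four_form_eqI)
  show "supported M 4 (ext_d (- \<zeta>))" "supported M 4 (- ext_d \<zeta>)"
    using supported_ext_d[OF is_form_supported[OF is_form_uminus[OF assms]]]
      supported_diff[OF supported_zero supported_ext_d[OF is_form_supported[OF assms]]]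
    by (simp_all add: eval_nat_numeral)
  fix c x p q r s assume *: "c \<in> atlas M" "x \<in> cimg c"
  show "ext_d (- \<zeta>) c x [p, q, r, s] = (- ext_d \<zeta>) c x [p, q, r, s]"
    using ext_d_diff[OF is_form_smooth_components[OF is_form_zero]
        is_form_smooth_components[OF assms] *, of "[p, q, r, s]"]
    by (simp add: ext_d_zero)
qed

lemma derham_class_ext_d:
  assumes \<zeta>: "is_form M 3 \<zeta>" shows "derham_class M 4 (ext_d \<zeta>) = derham_class M 4 0"
proof -
  have "exact_form M 4 (\<eta> - ext_d \<zeta>) \<longleftrightarrow> exact_form M 4 (\<eta> - 0)" for \<eta>
    using exact_form_add_ext_d[OF _ \<zeta>, of "\<eta> - ext_d \<zeta>"]
      exact_form_add_ext_d[OF _ is_form_uminus[OF \<zeta>], of \<eta>]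
    by (auto simp: ext_d_uminus_3[OF \<zeta>])
  then show ?thesis by (simp add: derham_class_def)
qed

lemma wedge_zero_right: "\<omega> \<and>\<^sub>f 0 = (0 :: ('a, 'e) form)"
  by (intro ext) (simp add: wedge_def)

text \<open>
  The case to which all others reduce: forms that vanish are closed, \<open>\<beta> = 0\<close> is admissible for a
  closed \<open>\<alpha>\<close>, and \<open>\<gamma> = 0\<close> is admissible for a closed \<open>\<beta>\<close>.
\<close>

lemma DGV_zero:
  assumes F0: "foliation M (F 0)" and \<alpha>: "defining_form M (F 0) \<alpha>"
    and \<beta>: "beta_for M \<alpha> \<beta>" and \<gamma>: "gamma_for M \<alpha> \<beta> \<gamma>"
    and closed: "ext_d \<gamma> = 0 \<or> (\<exists>\<delta>. delta_for M \<alpha> \<beta> \<gamma> \<delta> \<and> ext_d \<delta> = 0)"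
    and DGV: "has_DGV M F C"
  shows "C = derham_class M 4 0"
proof -
  from DGV obtain \<epsilon> \<alpha>t \<beta>t where \<epsilon>: "0 \<in> {-\<epsilon><..<\<epsilon>}"
    and fam: "smooth_form_family M 1 \<epsilon> \<alpha>t" "smooth_form_family M 1 \<epsilon> \<beta>t"
    and str: "\<And>s. s \<in> {-\<epsilon><..<\<epsilon>} \<Longrightarrow> defining_form M (F s) (\<alpha>t s) \<and> beta_for M (\<alpha>t s) (\<beta>t s)"
    and C: "C = derham_class M 4 (tgv_form \<beta>t 0)"
    unfolding has_DGV_def has_TGV_def by blast
  let ?a = "form_dot \<alpha>t 0" and ?b = "form_dot \<beta>t 0"
  have d\<alpha>t: "ext_d (\<alpha>t s) = \<alpha>t s \<and>\<^sub>f \<beta>t s" if "s \<in> {-\<epsilon><..<\<epsilon>}" for s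
    using str[OF that] by (simp add: beta_for_def)
  have forms: "is_form M 1 (\<alpha>t 0)" "is_form M 1 (\<beta>t 0)" "is_form M 1 ?a" "is_form M 1 ?b"
      "is_form M 1 \<beta>" "is_form M 1 \<gamma>"
    using fam \<epsilon> is_form_form_dot \<beta> \<gamma>
    by (auto simp: smooth_form_family_def beta_for_def gamma_for_def)
  have \<alpha>_form: "is_form M 1 \<alpha>"
    and nz: "\<And>c x. c \<in> atlas M \<Longrightarrow> x \<in> cimg c \<Longrightarrow> \<exists>v. \<alpha> c x [v] \<noteq> 0"
    using \<alpha> by (auto simp: defining_form_def)
  obtain k where k: "is_form M 0 k" "\<alpha> = k \<and>\<^sub>f \<alpha>t 0"
    "\<And>c x. c \<in> atlas M \<Longrightarrow> x \<in> cimg c \<Longrightarrow> k c x [] > 0"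
    using defining_forms_proportional[OF F0 \<alpha>] str[OF \<epsilon>] by blast
  have d\<alpha>: "ext_d \<alpha> = \<alpha> \<and>\<^sub>f \<beta>" and d\<beta>: "ext_d \<beta> = \<alpha> \<and>\<^sub>f \<gamma>"
    using \<beta> \<gamma> by (simp_all add: beta_for_def gamma_for_def)
  obtain A b' \<eta> where A: "is_form M 1 A" and b': "is_form M 1 b'" and \<eta>: "is_form M 3 \<eta>"
    and dA: "ext_d A = A \<and>\<^sub>f \<beta> + \<alpha> \<and>\<^sub>f b'"
    and eq: "?b \<and>\<^sub>f \<beta>t 0 \<and>\<^sub>f ext_d (\<beta>t 0) = b' \<and>\<^sub>f \<beta> \<and>\<^sub>f ext_d \<beta> + ext_d \<eta>"
    using tgv_form_gauge_change[OF forms k(1) d\<alpha>t[OF \<epsilon>] ext_d_form_dot[OF fam \<epsilon> d\<alpha>t] k(2,3) nz d\<alpha> d\<beta>]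
    by blast
  have "exact_form M 4 (b' \<and>\<^sub>f \<beta> \<and>\<^sub>f ext_d \<beta>)"
    using closed
  proof
    assume "ext_d \<gamma> = 0"
    then show ?thesis
      using tgv_form_zero_if_closed_gamma[OF \<alpha>_form forms(5,6) b' d\<alpha> d\<beta>] by (simp add: exact_form_def)
  next
    assume "\<exists>\<delta>. delta_for M \<alpha> \<beta> \<gamma> \<delta> \<and> ext_d \<delta> = 0"
    then obtain \<delta> where \<delta>: "is_form M 1 \<delta>" "ext_d \<gamma> = \<beta> \<and>\<^sub>f \<gamma> + \<alpha> \<and>\<^sub>f \<delta>" "ext_d \<delta> = 0"
      by (auto simp: delta_for_def)
    have "is_form M 3 (A \<and>\<^sub>f ext_d \<gamma>)"
      by (intro is_form_wedge_1_2 A is_form_ext_d_1 forms)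
    then show ?thesis
      unfolding tgv_form_exact_if_closed_delta[OF \<alpha>_form forms(5,6) \<delta>(1) A b' d\<alpha> d\<beta> \<delta>(2,3) dA]
        exact_form_4_iff by blast
  qed
  then have "exact_form M 4 (tgv_form \<beta>t 0)"
    unfolding tgv_form_def eq by (rule exact_form_add_ext_d[OF _ \<eta>])
  then obtain \<zeta> where "is_form M 3 \<zeta>" "tgv_form \<beta>t 0 = ext_d \<zeta>"
    unfolding exact_form_4_iff by blast
  then show ?thesis unfolding C using derham_class_ext_d by simp
qed

end

theorem theorem8:
  fixes M :: "('a, 'e::euclidean_space) mfd" and F0 :: "'a foliation"
  assumes "smooth_manifold M" and "foliation M F0"
  shows "((\<exists>\<alpha>. defining_form M F0 \<alpha> \<and>
            ((\<exists>\<beta>. beta_for M \<alpha> \<beta> \<and> \<beta> = 0) \<or>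
             (\<exists>\<beta> \<gamma>. beta_for M \<alpha> \<beta> \<and> gamma_for M \<alpha> \<beta> \<gamma> \<and> \<gamma> = 0) \<or>
             (\<exists>\<beta> \<gamma> \<delta>. beta_for M \<alpha> \<beta> \<and> gamma_for M \<alpha> \<beta> \<gamma> \<and> delta_for M \<alpha> \<beta> \<gamma> \<delta> \<and> \<delta> = 0)))
         \<longrightarrow> (\<forall>F C. foliation_family_germ M F \<and> F 0 = F0 \<and> has_DGV M F C
                \<longrightarrow> C = derham_class M 4 0)) \<and>
         ((\<exists>\<alpha>. defining_form M F0 \<alpha> \<and>
            (closed_form M 1 \<alpha> \<or>
             (\<exists>\<beta>. beta_for M \<alpha> \<beta> \<and> closed_form M 1 \<beta>) \<or>
             (\<exists>\<beta> \<gamma>. beta_for M \<alpha> \<beta> \<and> gamma_for M \<alpha> \<beta> \<gamma> \<and> closed_form M 1 \<gamma>) \<or>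
             (\<exists>\<beta> \<gamma> \<delta>. beta_for M \<alpha> \<beta> \<and> gamma_for M \<alpha> \<beta> \<gamma> \<and> delta_for M \<alpha> \<beta> \<gamma> \<delta> \<and> closed_form M 1 \<delta>)))
         \<longrightarrow> (\<forall>F C. foliation_family_germ M F \<and> F 0 = F0 \<and> has_DGV M F C
                \<longrightarrow> C = derham_class M 4 0))"
proof -
  interpret mfd_calculus M by (unfold_locales) (rule assms(1))
  let ?V = "\<forall>F C. foliation_family_germ M F \<and> F 0 = F0 \<and> has_DGV M F C \<longrightarrow> C = derham_class M 4 0"
  have V: ?V
    if "defining_form M F0 \<alpha>" "beta_for M \<alpha> \<beta>" "gamma_for M \<alpha> \<beta> \<gamma>"
      "ext_d \<gamma> = 0 \<or> (\<exists>\<delta>. delta_for M \<alpha> \<beta> \<gamma> \<delta> \<and> ext_d \<delta> = 0)" for \<alpha> \<beta> \<gamma>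
    using DGV_zero[OF _ _ that(2-4)] that(1) assms(2) by blast
  have V_\<beta>: ?V if "defining_form M F0 \<alpha>" "beta_for M \<alpha> \<beta>" "ext_d \<beta> = 0" for \<alpha> \<beta>
  proof (rule V[OF that(1,2)])
    show "gamma_for M \<alpha> \<beta> 0"
      using that(3) by (simp add: gamma_for_def is_form_zero wedge_zero_right)
  qed (simp add: ext_d_zero)
  have V_\<alpha>: ?V if "defining_form M F0 \<alpha>" "ext_d \<alpha> = 0" for \<alpha>
  proof (rule V_\<beta>[OF that(1)])
    show "beta_for M \<alpha> 0"
      using that(2) by (simp add: beta_for_def is_form_zero wedge_zero_right)
  qed (rule ext_d_zero)
  show ?thesis
  proof (intro conjI impI; elim exE conjE disjE)
    fix \<alpha> assume \<alpha>: "defining_form M F0 \<alpha>"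
    show ?V if "closed_form M 1 \<alpha>"
      using V_\<alpha>[OF \<alpha>] that unfolding closed_form_def by blast
    fix \<beta> assume \<beta>: "beta_for M \<alpha> \<beta>"
    show ?V if "\<beta> = 0" using V_\<beta>[OF \<alpha> \<beta>] that ext_d_zero by blast
    show ?V if "closed_form M 1 \<beta>" using V_\<beta>[OF \<alpha> \<beta>] that unfolding closed_form_def by blast
    fix \<gamma> assume \<gamma>: "gamma_for M \<alpha> \<beta> \<gamma>"
    show ?V if "\<gamma> = 0" using V[OF \<alpha> \<beta> \<gamma>] that ext_d_zero by blast
    show ?V if "closed_form M 1 \<gamma>" using V[OF \<alpha> \<beta> \<gamma>] that unfolding closed_form_def by blast
    fix \<delta> assume \<delta>: "delta_for M \<alpha> \<beta> \<gamma> \<delta>"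
    show ?V if "\<delta> = 0" using V[OF \<alpha> \<beta> \<gamma>] \<delta> that ext_d_zero by blast
    show ?V if "closed_form M 1 \<delta>" using V[OF \<alpha> \<beta> \<gamma>] \<delta> that unfolding closed_form_def by blast
  qed
qed

end
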